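(* Let $V$ be a simple vertex (super)algebra, and let $V^{\mathrm{Lie}}$ denote its underlying Lie conformal (super)algebra. Then either $V^{\mathrm{Lie}}$ is abelian, or it is an irreducible central extension of a simple Lie conformal (super)algebra.
   Context: All vector spaces are over $\mathbb{C}$. The prefix "super" is tacitly understood everywhere: spaces are $\mathbb{Z}/2\mathbb{Z}$-graded, $p(a)$ denotes the parity of a homogeneous element $a$, and subspaces, submodules and ideals are $\mathbb{Z}/2\mathbb{Z}$-graded. **Vertex algebras.** A field on a vector space $V$ is a formal distribution $\phi(z)=\sum_{i\in\mathbb{Z}}\phi_i z^{-i-1}\in(\operatorname{End}V)[[z,z^{-1}]]$ with $\phi(z)v\in V((z))$ for every $v\in V$. A vertex (super)algebra is a vector superspace $V=V_0\oplus V_1$ with a linear parity preserving state-field correspondence $Y:V\to(\operatorname{End}V)[[z,z^{-1}]]$, a vacuum element $\mathbf{1}\in V_0$ and an even operator $T\in\operatorname{End}V$ such that: (i) $Y(v,z)$ is a field for all $v\in V$; (ii) (locality) for all homogeneous $a,b\in V$, $(z-w)^N\big(Y(a,z)Y(b,w)-(-1)^{p(a)p(b)}Y(b,w)Y(a,z)\big)=0$ for sufficiently large $N$; (iii) $Y(\mathbf{1},z)=\mathrm{id}_V$ and $Y(a,z)\mathbf{1}\equiv a \bmod zV[[z]]$ for all $a\in V$; (iv) $[T,Y(a,z)]=Y(Ta,z)=\frac{d}{dz}Y(a,z)$ for all $a\in V$. Write $Y(a,z)=\sum_{j\in\mathbb{Z}}a_{(j)}z^{-j-1}$. For subspaces $A,B\subset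 V$, $A\cdot B$ is the $\mathbb{C}$-linear span of all $a_{(j)}b$ with $a\in A$, $b\in B$, $j\in\mathbb{Z}$. An ideal of the vertex algebra $V$ is a $\mathbb{C}[T]$-submodule $I\subset V$ with $V\cdot I\subset I$. $V$ is simple if its only ideals are the trivial ones, $0$ and $V$. **Lie conformal algebras.** A Lie conformal (super)algebra is a $\mathbb{Z}/2\mathbb{Z}$-graded $\mathbb{C}[\partial]$-module $R=R_0\oplus R_1$ with a parity preserving $\mathbb{C}$-bilinear product $(a,b)\mapsto[a\,_\lambda\,b]\in R[\lambda]$ such that, for all homogeneous $a,b,c\in R$: $[\partial a\,_\lambda\,b]=-\lambda[a\,_\lambda\,b]$ and $[a\,_\lambda\,\partial b]=(\partial+\lambda)[a\,_\lambda\,b]$; $[a\,_\lambda\,b]=-(-1)^{p(a)p(b)}[b\,_{-\partial-\lambda}\,a]$; and $[a\,_\lambda\,[b\,_\mu\,c]]-(-1)^{p(a)p(b)}[b\,_\mu\,[a\,_\lambda\,c]]=[[a\,_\lambda\,b]\,_{\lambda+\mu}\,c]$. For subspaces $A,B\subset R$, $[A,B]$ is the $\mathbb{C}$-linear span of all $\lambda$-coefficients of the products $[a\,_\lambda\,b]$, $a\in A$, $b\in B$. An ideal of $R$ is a $\mathbb{C}[\partial]$-submodule $I\subset R$ with $[R,I]\subset I$. $R$ is abelian if $[R,R]=0$; $R$ is simple if its only ideals are the trivial ones, $0$ and $R$, and $R$ is not abelian. The centre of $R$ is $Z=\{r\in R : [r\,_\lambda\,s]=0\text{ for all }s\in R\}$;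 an ideal $I$ is central if $[R,I]=0$, i.e. $I\subset Z$. $R$ is a central extension of a Lie conformal algebra $L$ if $L\cong R/I$ as Lie conformal algebras for some central ideal $I$ of $R$; the central extension is irreducible if moreover $R$ equals its derived subalgebra, $R=[R,R]$. **Underlying Lie conformal algebra.** For a vertex algebra $V$, $V^{\mathrm{Lie}}$ is the space $V$ with $\partial=T$ and $[a\,_\lambda\,b]=\sum_{n\ge0}\frac{\lambda^n}{n!}a_{(n)}b$; this is a Lie conformal (super)algebra. *)

theory Defs
  imports
    Complex_Main
    "HOL-Library.Z2"
    "HOL-Algebra.Module"
    "HOL-Algebra.QuotRing"
    "HOL-Algebra.Algebraic_Closure_Type"
begin

text \<open>
  Parities are elements of \<^typ>\<open>bit\<close>, the field with two elements.  A vector superspace comes with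
  its family of homogeneous components, indexed by \<^typ>\<open>bit\<close>; ``homogeneous of parity \<open>p\<close>'' means
  membership in component \<open>p\<close>.

  A vertex superalgebra lives on a whole type of class \<^class>\<open>ab_group_add\<close>.  Lie conformal
  superalgebras have an explicit carrier, in the style of HOL-Algebra, because their quotients are
  carried by sets of cosets.
\<close>

definition koszul_sign :: "bit \<Rightarrow> bit \<Rightarrow> complex" where
  "koszul_sign p q = (if p * q = 1 then -1 else 1)"

abbreviation complex_ring :: "complex ring" where
  "complex_ring \<equiv> ring_of_type_algebra"


section \<open>Vertex superalgebras\<close>

text \<open>
  \<open>mode V a n b\<close> is \<open>a\<^sub>(\<^sub>n\<^sub>) b\<close>, so that \<open>Y(a,z) b = \<Sum>n. (mode V a n b) z\<^bsup>-n-1\<^esup>\<close>, with \<open>n\<close> ranging over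
  the integers.
\<close>

record 'v vertex_data =
  vscale :: "complex \<Rightarrow> 'v \<Rightarrow> 'v"
  vpart :: "bit \<Rightarrow> 'v set"
  vac :: 'v
  transl :: "'v \<Rightarrow> 'v"
  mode :: "'v \<Rightarrow> int \<Rightarrow> 'v \<Rightarrow> 'v"

text \<open>
  Multiplication by \<open>z - w\<close> of \<open>\<Sum>m n. \<phi> m n z\<^bsup>-m-1\<^esup> w\<^bsup>-n-1\<^esup>\<close>, on coefficients.
\<close>

definition times_z_minus_w :: "(int \<Rightarrow> int \<Rightarrow> 'v) \<Rightarrow> int \<Rightarrow> int \<Rightarrow> 'v::ab_group_add" where
  "times_z_minus_w \<phi> = (\<lambda>m n. \<phi> (m + 1) n - \<phi> m (n + 1))"

locale vertex_superalgebra = vector_space "vscale V"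
  for V :: "'v::ab_group_add vertex_data" +
  assumes part_subspace: "subspace (vpart V p)"
    and part_disjoint: "vpart V 0 \<inter> vpart V 1 = {0}"
    and part_sum: "\<exists>x\<^sub>0\<in>vpart V 0. \<exists>x\<^sub>1\<in>vpart V 1. x = x\<^sub>0 + x\<^sub>1"
    and mode_add_left: "mode V (a + a') n b = mode V a n b + mode V a' n b"
    and mode_scale_left: "mode V (vscale V k a) n b = vscale V k (mode V a n b)"
    and mode_add_right: "mode V a n (b + b') = mode V a n b + mode V a n b'"
    and mode_scale_right: "mode V a n (vscale V k b) = vscale V k (mode V a n b)"
    and mode_parity: "a \<in> vpart V p \<Longrightarrow> b \<in> vpart V q \<Longrightarrow> mode V a n b \<in> vpart V (p + q)"
    and field: "\<exists>N. \<forall>n\<ge>N. mode V a n b = 0"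
    and locality: "a \<in> vpart V p \<Longrightarrow> b \<in> vpart V q \<Longrightarrow>
      \<exists>N\<^sub>0. \<forall>N\<ge>N\<^sub>0. \<forall>c.
        (times_z_minus_w ^^ N)
          (\<lambda>m n. mode V a m (mode V b n c)
            - vscale V (koszul_sign p q) (mode V b n (mode V a m c)))
        = (\<lambda>m n. 0)"
    and vac_even: "vac V \<in> vpart V 0"
    and vac_left: "mode V (vac V) n b = (if n = -1 then b else 0)"
    and vac_right: "mode V a (-1) (vac V) = a" "n \<ge> 0 \<Longrightarrow> mode V a n (vac V) = 0"
    and transl_add: "transl V (a + b) = transl V a + transl V b"
    and transl_scale: "transl V (vscale V k a) = vscale V k (transl V a)"
    and transl_even: "a \<in> vpart V p \<Longrightarrow> transl V a \<in> vpart V p"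
    and transl_commutator:
      "transl V (mode V a n b) - mode V a n (transl V b) = mode V (transl V a) n b"
    and transl_derivative: "mode V (transl V a) n b = vscale V (of_int (- n)) (mode V a (n - 1) b)"

definition vertex_product ::
    "'v::ab_group_add vertex_data \<Rightarrow> 'v set \<Rightarrow> 'v set \<Rightarrow> 'v set" where
  "vertex_product V A B = module.span (vscale V) {mode V a j b | a j b. a \<in> A \<and> b \<in> B}"

definition graded_subspace :: "'v::ab_group_add vertex_data \<Rightarrow> 'v set \<Rightarrow> bool" where
  "graded_subspace V U \<longleftrightarrow> module.subspace (vscale V) U \<and>
     (\<forall>x\<in>U. \<exists>x\<^sub>0\<in>U \<inter> vpart V 0. \<exists>x\<^sub>1\<in>U \<inter> vpart V 1. x = x\<^sub>0 + x\<^sub>1)"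

definition vertex_ideal :: "'v::ab_group_add vertex_data \<Rightarrow> 'v set \<Rightarrow> bool" where
  "vertex_ideal V I \<longleftrightarrow> graded_subspace V I \<and> transl V ` I \<subseteq> I \<and> vertex_product V UNIV I \<subseteq> I"

definition simple_vertex :: "'v::ab_group_add vertex_data \<Rightarrow> bool" where
  "simple_vertex V \<longleftrightarrow> (\<forall>I. vertex_ideal V I \<longrightarrow> I = {0} \<or> I = UNIV)"


section \<open>Lie conformal superalgebras\<close>

text \<open>
  The fields \<open>mult\<close> and \<open>one\<close>, inherited from HOL-Algebra modules, play no role.
  \<open>lbracket R a b n\<close> is the coefficient of \<open>\<lambda>\<^sup>n\<close> in \<open>[a\<^sub>\<lambda> b]\<close>; polynomials in \<open>\<lambda>\<close> with
  coefficients in \<open>R\<close> are sequences of coefficients with finite support.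
\<close>

record 'a lie_conformal = "(complex, 'a) module" +
  part :: "bit \<Rightarrow> 'a set"
  der :: "'a \<Rightarrow> 'a"
  lbracket :: "'a \<Rightarrow> 'a \<Rightarrow> nat \<Rightarrow> 'a"

definition const_poly :: "('a, 'm) lie_conformal_scheme \<Rightarrow> 'a \<Rightarrow> nat \<Rightarrow> 'a" where
  "const_poly R a = (\<lambda>n. if n = 0 then a else \<zero>\<^bsub>R\<^esub>)"

definition times_lambda :: "('a, 'm) lie_conformal_scheme \<Rightarrow> (nat \<Rightarrow> 'a) \<Rightarrow> nat \<Rightarrow> 'a" where
  "times_lambda R P = (\<lambda>n. case n of 0 \<Rightarrow> \<zero>\<^bsub>R\<^esub> | Suc m \<Rightarrow> P m)"

text \<open>The operator \<open>-\<partial> - \<lambda>\<close> on \<open>R[\<lambda>]\<close>.\<close>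

definition neg_der_lambda :: "('a, 'm) lie_conformal_scheme \<Rightarrow> (nat \<Rightarrow> 'a) \<Rightarrow> nat \<Rightarrow> 'a" where
  "neg_der_lambda R P = (\<lambda>n. \<ominus>\<^bsub>R\<^esub> (der R (P n) \<oplus>\<^bsub>R\<^esub> times_lambda R P n))"

text \<open>
  For \<open>P(\<lambda>) = \<Sum>n. \<lambda>\<^sup>n c\<^sub>n\<close>, this is \<open>P(-\<partial>-\<lambda>) = \<Sum>n. (-\<partial>-\<lambda>)\<^sup>n c\<^sub>n\<close>.
\<close>

definition subst_neg_der_lambda ::
    "('a, 'm) lie_conformal_scheme \<Rightarrow> (nat \<Rightarrow> 'a) \<Rightarrow> nat \<Rightarrow> 'a" where
  "subst_neg_der_lambda R P =
     (\<lambda>k. \<Oplus>\<^bsub>R\<^esub>n\<in>{n. P n \<noteq> \<zero>\<^bsub>R\<^esub>}. (neg_der_lambda R ^^ n) (const_poly R (P n)) k)"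

text \<open>
  The Jacobi identity is stated on the coefficients of \<open>\<lambda>\<^sup>m \<mu>\<^sup>n\<close>.  On its right-hand side,
  \<open>[[a\<^sub>\<lambda> b]\<^bsub>\<lambda>+\<mu>\<^esub> c] = \<Sum>k l. \<lambda>\<^sup>k (\<lambda>+\<mu>)\<^sup>l u\<^bsub>k,l\<^esub>\<close>, where \<open>u\<^bsub>k,l\<^esub>\<close> is
  \<open>lbracket R (lbracket R a b k) c l\<close>; only the terms with \<open>k \<le> m\<close> and \<open>l = m + n - k\<close> contribute,
  with the binomial coefficient of \<open>\<mu>\<^sup>n\<close> in \<open>(\<lambda>+\<mu>)\<^sup>l\<close>.
\<close>

locale lie_conformal_superalgebra = module complex_ring R
  for R :: "('a, 'm) lie_conformal_scheme" (structure) +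
  assumes part_submodule: "submodule (part R p) complex_ring R"
    and part_disjoint: "part R 0 \<inter> part R 1 = {\<zero>}"
    and part_sum: "carrier R = set_add R (part R 0) (part R 1)"
    and der_closed: "a \<in> carrier R \<Longrightarrow> der R a \<in> carrier R"
    and der_add: "a \<in> carrier R \<Longrightarrow> b \<in> carrier R \<Longrightarrow> der R (a \<oplus> b) = der R a \<oplus> der R b"
    and der_smult: "a \<in> carrier R \<Longrightarrow> der R (k \<odot> a) = k \<odot> der R a"
    and der_even: "a \<in> part R p \<Longrightarrow> der R a \<in> part R p"
    and bracket_closed: "a \<in> carrier R \<Longrightarrow> b \<in> carrier R \<Longrightarrow> lbracket R a b n \<in> carrier R"
    and bracket_finite:
      "a \<in> carrier R \<Longrightarrow> b \<in> carrier R \<Longrightarrow> finite {n. lbracket R a b n \<noteq> \<zero>}"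
    and bracket_add_left: "a \<in> carrier R \<Longrightarrow> a' \<in> carrier R \<Longrightarrow> b \<in> carrier R \<Longrightarrow>
      lbracket R (a \<oplus> a') b n = lbracket R a b n \<oplus> lbracket R a' b n"
    and bracket_smult_left: "a \<in> carrier R \<Longrightarrow> b \<in> carrier R \<Longrightarrow>
      lbracket R (k \<odot> a) b n = k \<odot> lbracket R a b n"
    and bracket_add_right: "a \<in> carrier R \<Longrightarrow> b \<in> carrier R \<Longrightarrow> b' \<in> carrier R \<Longrightarrow>
      lbracket R a (b \<oplus> b') n = lbracket R a b n \<oplus> lbracket R a b' n"
    and bracket_smult_right: "a \<in> carrier R \<Longrightarrow> b \<in> carrier R \<Longrightarrow>
      lbracket R a (k \<odot> b) n = k \<odot> lbracket R a b n"
    and bracket_parity: "a \<in> part R p \<Longrightarrow> b \<in> part R q \<Longrightarrow> lbracket R a b n \<in> part R (p + q)"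
    and sesquilinear_left: "a \<in> part R p \<Longrightarrow> b \<in> part R q \<Longrightarrow>
      lbracket R (der R a) b n = \<ominus> times_lambda R (lbracket R a b) n"
    and sesquilinear_right: "a \<in> part R p \<Longrightarrow> b \<in> part R q \<Longrightarrow>
      lbracket R a (der R b) n = der R (lbracket R a b n) \<oplus> times_lambda R (lbracket R a b) n"
    and skew_symmetry: "a \<in> part R p \<Longrightarrow> b \<in> part R q \<Longrightarrow>
      lbracket R a b n = \<ominus> (koszul_sign p q \<odot> subst_neg_der_lambda R (lbracket R b a) n)"
    and jacobi: "a \<in> part R p \<Longrightarrow> b \<in> part R q \<Longrightarrow> c \<in> part R r \<Longrightarrow>
      lbracket R a (lbracket R b c n) m \<ominus> koszul_sign p q \<odot> lbracket R b (lbracket R a c m) n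
      = (\<Oplus>k\<in>{..m}. of_nat ((m + n - k) choose n) \<odot> lbracket R (lbracket R a b k) c (m + n - k))"

definition bracket_span ::
    "('a, 'm) lie_conformal_scheme \<Rightarrow> 'a set \<Rightarrow> 'a set \<Rightarrow> 'a set" where
  "bracket_span R A B =
     (\<lambda>U. submodule U complex_ring R) hull {lbracket R a b n | a b n. a \<in> A \<and> b \<in> B}"

definition graded_submodule :: "('a, 'm) lie_conformal_scheme \<Rightarrow> 'a set \<Rightarrow> bool" where
  "graded_submodule R U \<longleftrightarrow> submodule U complex_ring R \<and>
     U = set_add R (U \<inter> part R 0) (U \<inter> part R 1)"

definition lie_conformal_ideal :: "('a, 'm) lie_conformal_scheme \<Rightarrow> 'a set \<Rightarrow> bool" where
  "lie_conformal_ideal R I \<longleftrightarrow>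
     graded_submodule R I \<and> der R ` I \<subseteq> I \<and> bracket_span R (carrier R) I \<subseteq> I"

definition abelian_lie_conformal :: "('a, 'm) lie_conformal_scheme \<Rightarrow> bool" where
  "abelian_lie_conformal R \<longleftrightarrow> bracket_span R (carrier R) (carrier R) = {\<zero>\<^bsub>R\<^esub>}"

definition simple_lie_conformal :: "('a, 'm) lie_conformal_scheme \<Rightarrow> bool" where
  "simple_lie_conformal R \<longleftrightarrow> lie_conformal_superalgebra R \<and>
     (\<forall>I. lie_conformal_ideal R I \<longrightarrow> I = {\<zero>\<^bsub>R\<^esub>} \<or> I = carrier R) \<and>
     \<not> abelian_lie_conformal R"

text \<open>
  The operations on cosets follow the pattern of \<^const>\<open>rcoset_mult\<close>: they collect the cosets of
  all results on representatives.
\<close>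

definition quotient_lie_conformal ::
    "('a, 'm) lie_conformal_scheme \<Rightarrow> 'a set \<Rightarrow> 'a set lie_conformal" where
  "quotient_lie_conformal R I =
    \<lparr>carrier = a_rcosets\<^bsub>R\<^esub> I, monoid.mult = undefined, one = undefined, ring.zero = I, add = set_add R,
     module.smult = (\<lambda>k A. \<Union>x\<in>A. I +>\<^bsub>R\<^esub> (k \<odot>\<^bsub>R\<^esub> x)),
     part = (\<lambda>p. (\<lambda>x. I +>\<^bsub>R\<^esub> x) ` part R p),
     der = (\<lambda>A. \<Union>x\<in>A. I +>\<^bsub>R\<^esub> der R x),
     lbracket = (\<lambda>A B n. \<Union>x\<in>A. \<Union>y\<in>B. I +>\<^bsub>R\<^esub> lbracket R x y n)\<rparr>"

definition lie_conformal_iso ::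
    "('a, 'm) lie_conformal_scheme \<Rightarrow> ('b, 'n) lie_conformal_scheme \<Rightarrow> ('a \<Rightarrow> 'b) set" where
  "lie_conformal_iso R S = {f. bij_betw f (carrier R) (carrier S) \<and>
     (\<forall>p. f ` part R p = part S p) \<and>
     (\<forall>a\<in>carrier R. \<forall>b\<in>carrier R. f (a \<oplus>\<^bsub>R\<^esub> b) = f a \<oplus>\<^bsub>S\<^esub> f b) \<and>
     (\<forall>k. \<forall>a\<in>carrier R. f (k \<odot>\<^bsub>R\<^esub> a) = k \<odot>\<^bsub>S\<^esub> f a) \<and>
     (\<forall>a\<in>carrier R. f (der R a) = der S (f a)) \<and>
     (\<forall>a\<in>carrier R. \<forall>b\<in>carrier R. \<forall>n. f (lbracket R a b n) = lbracket S (f a) (f b) n)}"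

definition central_ideal :: "('a, 'm) lie_conformal_scheme \<Rightarrow> 'a set \<Rightarrow> bool" where
  "central_ideal R I \<longleftrightarrow> lie_conformal_ideal R I \<and> bracket_span R (carrier R) I = {\<zero>\<^bsub>R\<^esub>}"

definition central_extension ::
    "('a, 'm) lie_conformal_scheme \<Rightarrow> ('b, 'n) lie_conformal_scheme \<Rightarrow> bool" where
  "central_extension R L \<longleftrightarrow> lie_conformal_superalgebra R \<and> lie_conformal_superalgebra L \<and>
     (\<exists>I. central_ideal R I \<and> lie_conformal_iso L (quotient_lie_conformal R I) \<noteq> {})"

definition irreducible_central_extension ::
    "('a, 'm) lie_conformal_scheme \<Rightarrow> ('b, 'n) lie_conformal_scheme \<Rightarrow> bool" where
  "irreducible_central_extension R L \<longleftrightarrow>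
     central_extension R L \<and> carrier R = bracket_span R (carrier R) (carrier R)"


section \<open>The Lie conformal superalgebra underlying a vertex superalgebra\<close>

definition underlying_lie :: "'v::ab_group_add vertex_data \<Rightarrow> 'v lie_conformal" where
  "underlying_lie V =
    \<lparr>carrier = UNIV, monoid.mult = undefined, one = undefined, ring.zero = 0, add = (+),
     module.smult = vscale V, part = vpart V, der = transl V,
     lbracket = (\<lambda>a b n. vscale V (1 / fact n) (mode V a (int n) b))\<rparr>"

end

theory Submission
  imports Defs
begin

text \<open>
  Write \<open>R\<close> for \<open>V\<^bsup>Lie\<^esup>\<close> and \<open>[R, R]\<close> for the span of all \<open>a\<^sub>(\<^sub>n\<^sub>) b\<close> with \<open>n \<ge> 0\<close>.  The argument
  compares ideals of \<open>R\<close>, which are stable under modes of nonnegative index, with ideals of \<open>V\<close>, which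
  are stable under all modes.

  For a graded \<open>T\<close>-stable subspace \<open>I\<close>, the vectors \<open>x\<close> with \<open>c\<^sub>(\<^sub>n\<^sub>) x \<in> I\<close> for all \<open>c\<close> and \<open>n\<close> form a vertex
  ideal contained in \<open>I\<close>, here called the core of \<open>I\<close> (\<open>vertex_ideal_vertex_core\<close>).  When \<open>V\<close> is simple,
  the core of \<open>I\<close> is therefore \<open>0\<close> unless \<open>I = V\<close>.

  The core is large: suppose that \<open>a\<close> is homogeneous and \<open>a\<^sub>(\<^sub>m\<^sub>) V \<subseteq> I\<close> for all \<open>m \<ge> 0\<close>.  For large \<open>m\<close>
  the commutator formula reads
  \<open>a\<^sub>(\<^sub>m\<^sub>) b\<^sub>(\<^sub>s\<^sub>-\<^sub>m\<^sub>) c = \<Sum>j. (m choose j) (a\<^sub>(\<^sub>j\<^sub>) b)\<^sub>(\<^sub>s\<^sub>-\<^sub>j\<^sub>) c\<close>.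
  Its left-hand side is in \<open>I\<close>, and since the polynomials \<open>m choose j\<close> are linearly independent, all vectors
  \<open>(a\<^sub>(\<^sub>j\<^sub>) b)\<^sub>(\<^sub>k\<^sub>) c\<close> with \<open>j \<ge> 0\<close> and \<open>k\<close> an arbitrary integer are in \<open>I\<close> (\<open>bracket_modes_in\<close>).  Hence all \<open>a\<^sub>(\<^sub>j\<^sub>) b\<close> with
  \<open>j \<ge> 0\<close> lie in the core of \<open>I\<close> (\<open>bracket_in_vertex_core\<close>).

  For an ideal \<open>I\<close> of \<open>R\<close> this applies to the homogeneous \<open>a \<in> I\<close>, by skew-symmetry; so \<open>[I, R] = 0\<close> or
  \<open>I = V\<close> (\<open>simple_Lie_ideal\<close>).  For \<open>I = [R, R]\<close> it applies to all homogeneous \<open>a\<close>; so \<open>[R, R] = 0\<close> or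
  \<open>[R, R] = R\<close> (\<open>simple_derived\<close>).  In the second case the centre \<open>Z\<close> of \<open>R\<close> is the largest proper ideal, and \<open>R/Z\<close>
  is simple: it is not abelian, since \<open>[R, R] = R\<close> is not contained in \<open>Z\<close>.

  What has to be derived from the axioms of a vertex superalgebra is the commutator formula, by Dong's
  lemma and Goddard's uniqueness theorem, and skew-symmetry, which is the commutator formula evaluated on
  the vacuum.
\<close>

section \<open>Formal distributions in two variables\<close>

lemma times_z_minus_w_zero_power:
  "(times_z_minus_w ^^ N) (\<lambda>m n. 0) = (\<lambda>m n. 0)"
  by (induction N) (simp_all add: times_z_minus_w_def)

lemma times_z_minus_w_power_diff:
  "(times_z_minus_w ^^ N) (\<lambda>m n. \<phi> m n - \<psi> m n)
     = (\<lambda>m n. (times_z_minus_w ^^ N) \<phi> m n - (times_z_minus_w ^^ N) \<psi> m n)"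
  by (induction N) (simp_all add: times_z_minus_w_def fun_eq_iff algebra_simps)

lemma times_z_minus_w_power_add:
  "(times_z_minus_w ^^ N) (\<lambda>m n. \<phi> m n + \<psi> m n)
     = (\<lambda>m n. (times_z_minus_w ^^ N) \<phi> m n + (times_z_minus_w ^^ N) \<psi> m n)"
  by (induction N) (simp_all add: times_z_minus_w_def fun_eq_iff algebra_simps)

lemma times_z_minus_w_power_sum:
  "(times_z_minus_w ^^ N) (\<lambda>m n. \<Sum>i\<in>S. \<phi> i m n)
     = (\<lambda>m n. \<Sum>i\<in>S. (times_z_minus_w ^^ N) (\<phi> i) m n)"
  by (induction N) (simp_all add: times_z_minus_w_def fun_eq_iff sum_subtractf)

lemma times_z_minus_w_power_map:
  assumes "\<And>x y. h (x - y) = h x - h y"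
  shows "(times_z_minus_w ^^ N) (\<lambda>m n. h (\<phi> m n)) = (\<lambda>m n. h ((times_z_minus_w ^^ N) \<phi> m n))"
  by (induction N) (simp_all add: times_z_minus_w_def fun_eq_iff assms)

lemma times_z_minus_w_power_shift:
  "(times_z_minus_w ^^ N) (\<lambda>m n. \<phi> m (n + s)) = (\<lambda>m n. (times_z_minus_w ^^ N) \<phi> m (n + s))"
proof (induction N)
  case (Suc N)
  have "n + s + 1 = n + 1 + s" for n
    by simp
  then show ?case
    unfolding funpow.simps comp_apply Suc by (simp only: times_z_minus_w_def)
qed simp

lemma times_z_minus_w_power_mono:
  assumes "(times_z_minus_w ^^ N) \<phi> = (\<lambda>m n. 0)" "N \<le> M"
  shows "(times_z_minus_w ^^ M) \<phi> = (\<lambda>m n. 0)"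
proof -
  have "(times_z_minus_w ^^ M) \<phi> = (times_z_minus_w ^^ (M - N)) ((times_z_minus_w ^^ N) \<phi>)"
    by (metis assms(2) comp_apply funpow_add le_add_diff_inverse2)
  then show ?thesis
    by (simp add: assms(1) times_z_minus_w_zero_power)
qed

text \<open>
  Division by \<open>(z - w)\<^sup>N\<close>, expanded in nonpositive powers of \<open>w\<close>.  A distribution can be divided
  once its \<open>z\<close>-modes are eventually zero; here \<open>zero\<close> is relaxed to \<open>in I\<close>.
\<close>

lemma times_z_minus_w_divide:
  fixes \<phi> :: "int \<Rightarrow> int \<Rightarrow> 'v::ab_group_add"
  assumes I: "0 \<in> I" "\<And>x y. x \<in> I \<Longrightarrow> y \<in> I \<Longrightarrow> x - y \<in> I"
    and "\<And>m n. (times_z_minus_w ^^ N) \<phi> m n \<in> I"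
    and "\<And>m n. m \<ge> m\<^sub>0 \<Longrightarrow> \<phi> m n \<in> I"
  shows "\<phi> m n \<in> I"
  using assms(3,4)
proof (induction N arbitrary: \<phi> m n)
  case 0
  then show ?case by simp
next
  case (Suc N)
  have diff: "times_z_minus_w \<phi> m n \<in> I" for m n
  proof (rule Suc.IH)
    show "(times_z_minus_w ^^ N) (times_z_minus_w \<phi>) m n \<in> I" for m n
      using Suc.prems(1) by (simp add: funpow_swap1)
    show "times_z_minus_w \<phi> m n \<in> I" if "m \<ge> m\<^sub>0" for m n
      using Suc.prems(2) that I(2) by (simp add: times_z_minus_w_def)
  qed
  have "\<phi> (m\<^sub>0 - int k) n \<in> I" for k n
  proof (induction k arbitrary: n)
    case 0
    show ?case using Suc.prems(2) by simp
  next
    case (Suc k)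
    have "\<phi> (m\<^sub>0 - int (Suc k)) n
        = \<phi> (m\<^sub>0 - int k) (n - 1) - (times_z_minus_w \<phi> (m\<^sub>0 - int (Suc k)) (n - 1))"
      by (simp add: times_z_minus_w_def add.commute)
    then show ?case
      using Suc.IH diff I(2) by presburger
  qed
  from this[of "nat (m\<^sub>0 - m)"] Suc.prems(2)[of m n] show ?case
    by (cases "m \<ge> m\<^sub>0") auto
qed

text \<open>
  Where \<open>A\<close> vanishes, \<open>B\<close> and \<open>C\<close> agree; so if \<open>A\<close> is nilpotent on \<open>f\<close>, a relation \<open>C\<^sup>p B\<^sup>q f = 0\<close> forces a power
  of \<open>C\<close> to kill \<open>f\<close>.  The exponent does not depend on \<open>f\<close>, which makes it uniform in all parameters on
  which a distribution depends.
\<close>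

lemma nilpotent_transfer:
  fixes A B C :: "'f \<Rightarrow> 'f"
  assumes zero: "A z = z" "B z = z" "C z = z"
    and comm: "\<And>g. A (B g) = B (A g)" "\<And>g. A (C g) = C (A g)" "\<And>g. B (C g) = C (B g)"
    and agree: "\<And>g. A g = z \<Longrightarrow> B g = C g"
    and "(A ^^ k) f = z" "(C ^^ p) ((B ^^ q) f) = z"
  shows "(C ^^ (k * (p + q))) f = z"
  using assms(8,9)
proof (induction k arbitrary: f)
  case 0
  then show ?case by simp
next
  case (Suc k)
  have C_zero: "(C ^^ i) z = z" for i
    by (induction i) (simp_all add: zero)
  have A_B: "A ((B ^^ i) g) = (B ^^ i) (A g)" for i g
    by (induction i) (simp_all add: comm)
  have A_C: "A ((C ^^ i) g) = (C ^^ i) (A g)" for i g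
    by (induction i) (simp_all add: comm)
  have B_C: "(B ^^ i) ((C ^^ j) g) = (C ^^ j) ((B ^^ i) g)" for i j g
  proof -
    have "B ((C ^^ j) g) = (C ^^ j) (B g)" for g
      by (induction j) (simp_all add: comm)
    then show ?thesis by (induction i) simp_all
  qed
  have C_C: "(C ^^ i) ((C ^^ j) g) = (C ^^ (i + j)) g" for i j g
    by (simp add: funpow_add)
  define h where "h = (C ^^ (k * (p + q))) f"
  have "(C ^^ (k * (p + q))) (A f) = z"
  proof (rule Suc.IH)
    show "(A ^^ k) (A f) = z"
      using Suc.prems(1) by (simp add: funpow_swap1)
    show "(C ^^ p) ((B ^^ q) (A f)) = z"
      using Suc.prems(2) zero(1) by (simp flip: A_B A_C)
  qed
  then have A_h: "A h = z"
    by (simp add: h_def A_C)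
  have B_h: "(B ^^ i) h = (C ^^ i) h" for i
  proof (induction i)
    case (Suc i)
    then show ?case
      using agree[of "(C ^^ i) h"] by (simp add: A_C A_h C_zero)
  qed simp
  have "(C ^^ p) ((B ^^ q) h) = (C ^^ (k * (p + q))) ((C ^^ p) ((B ^^ q) f))"
    unfolding h_def B_C C_C by (simp add: add.commute)
  also have "\<dots> = z"
    by (simp only: Suc.prems(2) C_zero)
  finally have "(C ^^ (p + q)) h = z"
    by (simp add: B_h C_C)
  then show ?case
    unfolding h_def C_C by (simp add: algebra_simps)
qed

section \<open>The commutator formula\<close>

lemma koszul_sign_square [simp]: "koszul_sign p q * koszul_sign p q = 1"
  by (simp add: koszul_sign_def)

lemma koszul_sign_square_left [simp]: "koszul_sign p q * (koszul_sign p q * k) = k"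
  by (simp add: koszul_sign_def)

lemma koszul_sign_nonzero [simp]: "koszul_sign p q \<noteq> 0"
  by (simp add: koszul_sign_def)

lemma koszul_sign_commute: "koszul_sign p q = koszul_sign q p"
  by (simp add: koszul_sign_def mult.commute)

lemma koszul_sign_add: "koszul_sign p (q + r) = koszul_sign p q * koszul_sign p r"
  by (cases p rule: bit.exhaust; cases q rule: bit.exhaust; cases r rule: bit.exhaust)
    (simp_all add: koszul_sign_def)

context vertex_superalgebra
begin

lemma mode_zero_left [simp]: "mode V 0 n b = 0"
  using mode_add_left[of 0 0 n b] by simp

lemma mode_zero_right [simp]: "mode V a n 0 = 0"
  using mode_add_right[of a n 0 0] by simp

lemma mode_minus_right: "mode V a n (- b) = - mode V a n b"
  using mode_add_right[of a n b "- b"] by (simp add: eq_neg_iff_add_eq_0 add.commute)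

lemma mode_diff_right: "mode V a n (b - c) = mode V a n b - mode V a n c"
  using mode_add_right[of a n b "- c"] by (simp add: mode_minus_right)

lemma mode_sum_right: "mode V a n (\<Sum>i\<in>S. f i) = (\<Sum>i\<in>S. mode V a n (f i))"
  by (induction S rule: infinite_finite_induct) (simp_all add: mode_add_right)

lemma transl_zero [simp]: "transl V 0 = 0"
  using transl_add[of 0 0] by simp

lemma transl_sum: "transl V (\<Sum>i\<in>S. f i) = (\<Sum>i\<in>S. transl V (f i))"
  by (induction S rule: infinite_finite_induct) (simp_all add: transl_add)

lemma mode_transl:
  "mode V a n (transl V b) = transl V (mode V a n b) + vscale V (of_int n) (mode V a (n - 1) b)"
  using transl_commutator[of a n b] by (simp add: transl_derivative scale_minus_left algebra_simps)

lemma transl_vac [simp]: "transl V (vac V) = 0"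
proof -
  have "transl V (vac V) = mode V (transl V (vac V)) (-1) (vac V)"
    by (simp add: vac_right)
  also have "\<dots> = 0"
    by (simp add: transl_derivative vac_left)
  finally show ?thesis .
qed

lemma transl_mode_vac: "transl V (mode V a n (vac V)) = - vscale V (of_int n) (mode V a (n - 1) (vac V))"
  using mode_transl[of a n "vac V"] by (simp add: add.commute eq_neg_iff_add_eq_0)

lemma homogeneous_induct:
  assumes "\<And>p x. x \<in> vpart V p \<Longrightarrow> P x" "\<And>x y. P x \<Longrightarrow> P y \<Longrightarrow> P (x + y)"
  shows "P x"
  using part_sum[of x] assms by blast

text \<open>
  The coefficients of \<open>[a(z), b(w)] c\<close>.  The parities are arguments of their own, since the vector \<open>0\<close>
  has both of them.
\<close>

definition supercommutator :: "bit \<Rightarrow> 'v \<Rightarrow> bit \<Rightarrow> 'v \<Rightarrow> int \<Rightarrow> int \<Rightarrow> 'v \<Rightarrow> 'v" where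
  "supercommutator p a q b m n c =
     mode V a m (mode V b n c) - vscale V (koszul_sign p q) (mode V b n (mode V a m c))"

lemma supercommutator_add:
  "supercommutator p a q b m n (c + d) = supercommutator p a q b m n c + supercommutator p a q b m n d"
  by (simp add: supercommutator_def mode_add_right scale_right_distrib)

lemma supercommutator_locality:
  assumes "a \<in> vpart V p" "b \<in> vpart V q"
  shows "\<forall>\<^sub>F N in sequentially. \<forall>c.
    (times_z_minus_w ^^ N) (\<lambda>m n. supercommutator p a q b m n c) = (\<lambda>m n. 0)"
  unfolding supercommutator_def eventually_sequentially using locality[OF assms] .

text \<open>
  Dong's lemma, for the residues of \<open>[a(x), b(w)]\<close>.  On \<open>f(x, w, z) = [c(z), [a(x), b(w)]]\<close> some
  power of \<open>x - w\<close> vanishes by locality, and by the Jacobi identity so does \<open>(z - w)\<^sup>N (z - x)\<^sup>N\<close>.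
  Modulo \<open>x - w\<close>, multiplication by \<open>z - x\<close> is multiplication by \<open>z - w\<close>.
\<close>

lemma dong:
  assumes a: "a \<in> vpart V p" and b: "b \<in> vpart V q" and c: "c \<in> vpart V r"
  shows "\<forall>\<^sub>F N in sequentially. \<forall>m u. (times_z_minus_w ^^ N)
    (\<lambda>k n. mode V c k (supercommutator p a q b m n u)
      - vscale V (koszul_sign r (p + q)) (supercommutator p a q b m n (mode V c k u))) = (\<lambda>k n. 0)"
proof -
  let ?ab = "koszul_sign p q" and ?ca = "koszul_sign r p" and ?cb = "koszul_sign r q"
  obtain N where ab: "\<And>u. (times_z_minus_w ^^ N) (\<lambda>m n. supercommutator p a q b m n u) = (\<lambda>m n. 0)"
    using eventually_happens'[OF _ supercommutator_locality[OF a b]] by auto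
  obtain P where cb: "\<And>u. (times_z_minus_w ^^ P) (\<lambda>m n. supercommutator r c q b m n u) = (\<lambda>m n. 0)"
    using eventually_happens'[OF _ supercommutator_locality[OF c b]] by auto
  obtain Q where ca: "\<And>u. (times_z_minus_w ^^ Q) (\<lambda>m n. supercommutator r c p a m n u) = (\<lambda>m n. 0)"
    using eventually_happens'[OF _ supercommutator_locality[OF c a]] by auto
  \<comment> \<open>multiplication of a function of \<open>x, w, z\<close> by \<open>x - w\<close>, \<open>z - x\<close> and \<open>z - w\<close>\<close>
  define A B C :: "(int \<Rightarrow> int \<Rightarrow> int \<Rightarrow> 'v) \<Rightarrow> int \<Rightarrow> int \<Rightarrow> int \<Rightarrow> 'v" where
    "A = (\<lambda>f x w z. times_z_minus_w (\<lambda>x w. f x w z) x w)" and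
    "B = (\<lambda>f x w z. times_z_minus_w (\<lambda>z x. f x w z) z x)" and
    "C = (\<lambda>f x w z. times_z_minus_w (\<lambda>z w. f x w z) z w)"
  have A_power: "(A ^^ k) f = (\<lambda>x w z. (times_z_minus_w ^^ k) (\<lambda>x w. f x w z) x w)" for k f
    by (induction k) (simp_all add: A_def)
  have B_power: "(B ^^ k) f = (\<lambda>x w z. (times_z_minus_w ^^ k) (\<lambda>z x. f x w z) z x)" for k f
    by (induction k) (simp_all add: B_def)
  have C_power: "(C ^^ k) f = (\<lambda>x w z. (times_z_minus_w ^^ k) (\<lambda>z w. f x w z) z w)" for k f
    by (induction k) (simp_all add: C_def)
  have "(times_z_minus_w ^^ (N * (P + Q)))
    (\<lambda>k n. mode V c k (supercommutator p a q b m n u)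
      - vscale V (koszul_sign r (p + q)) (supercommutator p a q b m n (mode V c k u))) = (\<lambda>k n. 0)"
    for m u
  proof -
    define f where "f = (\<lambda>x w z. mode V c z (supercommutator p a q b x w u)
      - vscale V (koszul_sign r (p + q)) (supercommutator p a q b x w (mode V c z u)))"
    define g where "g = (\<lambda>x w z. supercommutator r c p a z x (mode V b w u)
      - vscale V (?cb * ?ab) (mode V b w (supercommutator r c p a z x u)))"
    define h where "h = (\<lambda>x w z. vscale V ?ca (mode V a x (supercommutator r c q b z w u)
      - vscale V (?ca * ?ab) (supercommutator r c q b z w (mode V a x u))))"
    \<comment> \<open>the Jacobi identity \<open>[c, [a, b]] = [[c, a], b] \<plusminus> [a, [c, b]]\<close>\<close>
    have f_gh: "f x w z = g x w z + h x w z" for x w z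
      unfolding f_def koszul_sign_add
      by (simp add: g_def h_def supercommutator_def mode_diff_right mode_scale_right
          scale_right_diff_distrib mult_ac)
    have B_g: "(B ^^ Q) g = (\<lambda>x w z. 0)"
      by (simp add: B_power g_def times_z_minus_w_power_diff ca scale_right_diff_distrib
          mode_diff_right
          times_z_minus_w_power_map[where h = "\<lambda>x. vscale V k (mode V b n x)" for k n])
    have C_h: "(C ^^ P) h = (\<lambda>x w z. 0)"
      by (simp add: C_power h_def times_z_minus_w_power_diff cb scale_right_diff_distrib
          mode_diff_right
          times_z_minus_w_power_map[where h = "\<lambda>x. vscale V k (mode V b n x)" for k b n]
          times_z_minus_w_power_map[where h = "\<lambda>x. vscale V k x" for k])
    have comm_BC: "(C ^^ i) ((B ^^ j) g) = (B ^^ j) ((C ^^ i) g)" for i j g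
    proof -
      have "C (B g) = B (C g)" for g
        by (simp add: B_def C_def times_z_minus_w_def fun_eq_iff algebra_simps)
      then have "C ((B ^^ j) g) = (B ^^ j) (C g)" for g
        by (induction j) simp_all
      then show ?thesis
        by (induction i) simp_all
    qed
    have "(C ^^ (N * (P + Q))) f = (\<lambda>x w z. 0)"
    proof (rule nilpotent_transfer)
      show "A (\<lambda>x w z. 0) = (\<lambda>x w z. 0)" "B (\<lambda>x w z. 0) = (\<lambda>x w z. 0)" "C (\<lambda>x w z. 0) = (\<lambda>x w z. 0)"
        by (simp_all add: A_def B_def C_def times_z_minus_w_def)
      show "A (B g) = B (A g)" "A (C g) = C (A g)" "B (C g) = C (B g)" for g
        by (simp_all add: A_def B_def C_def times_z_minus_w_def fun_eq_iff algebra_simps)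
      show "B g = C g" if "A g = (\<lambda>x w z. 0)" for g
        using that by (simp add: A_def B_def C_def times_z_minus_w_def fun_eq_iff)
      show "(A ^^ N) f = (\<lambda>x w z. 0)"
        by (simp add: A_power f_def times_z_minus_w_power_diff ab scale_right_diff_distrib
            mode_diff_right
            times_z_minus_w_power_map[where h = "mode V c k" for k]
            times_z_minus_w_power_map[where h = "vscale V k" for k])
      have "(B ^^ Q) f = (\<lambda>x w z. (B ^^ Q) g x w z + (B ^^ Q) h x w z)"
        by (simp add: B_power f_gh times_z_minus_w_power_add)
      then have "(C ^^ P) ((B ^^ Q) f) = (C ^^ P) ((B ^^ Q) h)"
        by (simp add: B_g)
      also have "\<dots> = (\<lambda>x w z. 0)"
        unfolding comm_BC C_h by (simp add: B_power times_z_minus_w_zero_power)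
      finally show "(C ^^ P) ((B ^^ Q) f) = (\<lambda>x w z. 0)" .
    qed
    then show ?thesis
      by (simp add: C_power f_def fun_eq_iff)
  qed
  then show ?thesis
    unfolding eventually_sequentially using times_z_minus_w_power_mono by blast
qed

text \<open>
  A field \<open>F\<close> that is local with respect to every \<open>c(z)\<close> is determined by its value on the vacuum: if
  that is zero, locality gives
  \<open>(z - w)\<^sup>N F(w) c(z) 1 = 0\<close>, where \<open>c(z) 1\<close> has no negative powers of \<open>z\<close>.  Hence \<open>F(w) c(z) 1 = 0\<close>, and the
  constant term in \<open>z\<close> is \<open>F(w) c\<close>.
\<close>

lemma goddard_uniqueness:
  assumes add: "\<And>n x y. F n (x + y) = F n x + F n y"
    and local: "\<And>c r. c \<in> vpart V r \<Longrightarrow> \<exists>N k. k \<noteq> 0 \<and>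
      (times_z_minus_w ^^ N) (\<lambda>m n. mode V c m (F n (vac V)) - vscale V k (F n (mode V c m (vac V))))
        = (\<lambda>m n. 0)"
    and vac: "\<And>n. F n (vac V) = 0"
  shows "F n u = 0"
proof (rule homogeneous_induct[where x = u and P = "\<lambda>u. F n u = 0"])
  fix c r assume "c \<in> vpart V r"
  then obtain N k where k: "k \<noteq> 0" and N: "(times_z_minus_w ^^ N)
      (\<lambda>m n. mode V c m (F n (vac V)) - vscale V k (F n (mode V c m (vac V)))) = (\<lambda>m n. 0)"
    using local by blast
  have "- vscale V k (F (n::int) (mode V c (-1) (vac V))) \<in> {0}"
  proof (rule times_z_minus_w_divide[where N = N and m\<^sub>0 = 0
        and \<phi> = "\<lambda>m n. - vscale V k (F n (mode V c m (vac V)))"])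
    have "F n 0 = 0" for n
      using add[of n 0 0] by simp
    then show "- vscale V k (F n (mode V c m (vac V))) \<in> {0}" if "m \<ge> 0" for m n
      using that by (simp add: vac_right)
    show "(times_z_minus_w ^^ N) (\<lambda>m n. - vscale V k (F n (mode V c m (vac V)))) m n \<in> {0}" for m n
      using N by (simp add: vac)
  qed auto
  then show "F n c = 0"
    using k by (simp add: vac_right)
qed (simp add: add)

text \<open>
  The commutator formula on the vacuum, for \<open>m \<ge> 0\<close>: there \<open>a\<^sub>(\<^sub>m\<^sub>)\<close> kills the vacuum, and both
  sides obey the same recursion in \<open>n\<close> given by the translation operator.
\<close>

lemma mode_mode_vac:
  "mode V a (int m) (mode V b n (vac V))
     = (\<Sum>j\<le>m. vscale V (of_nat (m choose j)) (mode V (mode V a (int j) b) (int m + n - int j) (vac V)))"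
proof (cases "n \<ge> 0")
  case True
  then show ?thesis
    by (simp add: vac_right(2))
next
  case False
  have "mode V a (int m) (mode V b (-1 - int k) (vac V)) = (\<Sum>j\<le>m. vscale V (of_nat (m choose j))
          (mode V (mode V a (int j) b) (int m + (-1 - int k) - int j) (vac V)))" for k
  proof (induction k arbitrary: m)
    case 0
    have "(\<Sum>j\<le>m. vscale V (of_nat (m choose j)) (mode V (mode V a (int j) b) (int m - 1 - int j) (vac V)))
        = (\<Sum>j\<in>{m}. vscale V (of_nat (m choose j)) (mode V (mode V a (int j) b) (int m - 1 - int j) (vac V)))"
      by (rule sum.mono_neutral_right) (auto simp: vac_right(2))
    then show ?case
      by (simp add: vac_right(1))
  next
    case (Suc k)
    let ?x = "\<lambda>j i. mode V (mode V a (int j) b) i (vac V)"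
    let ?n = "-1 - int k"
    let ?s = "\<lambda>j. int m + ?n - int j"
    have prev: "vscale V (of_nat m) (mode V a (int m - 1) (mode V b ?n (vac V)))
        = (\<Sum>j\<le>m. vscale V (of_int (int m - int j) * of_nat (m choose j)) (?x j (?s j - 1)))"
    proof (cases m)
      case (Suc l)
      have "vscale V (of_nat m) (mode V a (int m - 1) (mode V b ?n (vac V)))
          = (\<Sum>j\<le>l. vscale V (of_nat m * of_nat (l choose j)) (?x j (int l + ?n - int j)))"
        using Suc.IH[of l] by (simp add: Suc scale_sum_right)
      also have "\<dots> = (\<Sum>j\<le>l. vscale V (of_int (int m - int j) * of_nat (m choose j)) (?x j (?s j - 1)))"
      proof (rule sum.cong)
        fix j assume "j \<in> {..l}"
        have "(of_nat m - of_nat j) * of_nat (m choose j) = (of_nat m * of_nat (l choose j) :: complex)"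
          using gbinomial_absorb_comp[of "of_nat m :: complex" j]
          by (simp add: Suc binomial_gbinomial)
        then show "vscale V (of_nat m * of_nat (l choose j)) (?x j (int l + ?n - int j))
            = vscale V (of_int (int m - int j) * of_nat (m choose j)) (?x j (?s j - 1))"
          by (simp add: Suc algebra_simps)
      qed simp
      also have "\<dots> = (\<Sum>j\<le>m. vscale V (of_int (int m - int j) * of_nat (m choose j)) (?x j (?s j - 1)))"
        by (simp add: Suc)
      finally show ?thesis .
    qed simp
    have "vscale V (of_nat (Suc k)) (mode V a (int m) (mode V b (?n - 1) (vac V)))
        = mode V a (int m) (transl V (mode V b ?n (vac V)))"
      by (simp add: transl_mode_vac mode_minus_right mode_scale_right scale_minus_left[symmetric]
          del: scale_minus_left)
    also have "\<dots> = transl V (mode V a (int m) (mode V b ?n (vac V)))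
        + vscale V (of_nat m) (mode V a (int m - 1) (mode V b ?n (vac V)))"
      by (simp add: mode_transl)
    also have "\<dots> = (\<Sum>j\<le>m. vscale V (- of_int (?s j) * of_nat (m choose j)) (?x j (?s j - 1)))
        + (\<Sum>j\<le>m. vscale V (of_int (int m - int j) * of_nat (m choose j)) (?x j (?s j - 1)))"
      by (simp add: Suc.IH prev transl_sum transl_scale transl_mode_vac mult.commute
          del: of_int_diff of_int_add)
    also have "\<dots> = (\<Sum>j\<le>m. vscale V (of_nat (Suc k) * of_nat (m choose j)) (?x j (?s j - 1)))"
      unfolding sum.distrib[symmetric] scale_left_distrib[symmetric]
      by (intro sum.cong refl arg_cong2[where f = "vscale V"]) (simp add: algebra_simps)
    also have "\<dots> = vscale V (of_nat (Suc k)) (\<Sum>j\<le>m. vscale V (of_nat (m choose j)) (?x j (?s j - 1)))"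
      by (simp add: scale_sum_right)
    finally have "mode V a (int m) (mode V b (?n - 1) (vac V))
        = (\<Sum>j\<le>m. vscale V (of_nat (m choose j)) (?x j (?s j - 1)))"
      by (rule scale_left_imp_eq[rotated]) (simp del: of_nat_Suc)
    moreover have "-1 - int (Suc k) = ?n - 1" "int m + (?n - 1) - int j = ?s j - 1" for j
      by simp_all
    ultimately show ?case
      by (simp only:)
  qed
  from this[of "nat (-1 - n)"] False show ?thesis
    by simp
qed

text \<open>
  For fixed \<open>m \<ge> 0\<close> both sides, as fields in \<open>w\<close>, are local with respect to every \<open>c(z)\<close>: the left one by
  Dong's lemma, the right one because it combines the fields of the vectors \<open>a\<^sub>(\<^sub>j\<^sub>) b\<close>.  They agree on the
  vacuum, hence everywhere.
\<close>

lemma commutator_formula_nonneg: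
  assumes a: "a \<in> vpart V p" and b: "b \<in> vpart V q"
    and J: "\<forall>j\<ge>J. mode V a (int j) b = 0"
  shows "supercommutator p a q b (int m) n c
    = (\<Sum>j<J. vscale V (of_nat (m choose j)) (mode V (mode V a (int j) b) (int m + n - int j) c))"
proof -
  define G where "G = (\<lambda>n c.
    \<Sum>j<J. vscale V (of_nat (m choose j)) (mode V (mode V a (int j) b) (int m + n - int j) c))"
  have "supercommutator p a q b (int m) n c - G n c = 0"
  proof (rule goddard_uniqueness[where F = "\<lambda>n c. supercommutator p a q b (int m) n c - G n c"])
    show "supercommutator p a q b (int m) n (x + y) - G n (x + y)
        = supercommutator p a q b (int m) n x - G n x + (supercommutator p a q b (int m) n y - G n y)"
      for n x y
      by (simp add: G_def supercommutator_add mode_add_right scale_right_distrib sum.distrib)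
    show "supercommutator p a q b (int m) n (vac V) - G n (vac V) = 0" for n
    proof -
      let ?t = "\<lambda>j. vscale V (of_nat (m choose j))
        (mode V (mode V a (int j) b) (int m + n - int j) (vac V))"
      have "supercommutator p a q b (int m) n (vac V) = (\<Sum>j\<le>m. ?t j)"
        by (simp add: supercommutator_def mode_mode_vac vac_right(2))
      also have "\<dots> = (\<Sum>j\<in>{..m} \<union> {..<J}. ?t j)"
        by (rule sum.mono_neutral_left) auto
      also have "\<dots> = G n (vac V)"
        unfolding G_def by (rule sum.mono_neutral_right) (auto simp: J)
      finally show ?thesis
        by simp
    qed
  next
    fix c r assume c: "c \<in> vpart V r"
    let ?k = "koszul_sign r (p + q)"
    have "\<forall>\<^sub>F N in sequentially. \<forall>j\<in>{..<J}. \<forall>u. (times_z_minus_w ^^ N)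
        (\<lambda>k n. supercommutator r c (p + q) (mode V a (int j) b) k n u) = (\<lambda>k n. 0)"
      by (intro eventually_ball_finite ballI supercommutator_locality c mode_parity a b) auto
    from eventually_happens'[OF sequentially_bot eventually_conj[OF dong[OF a b c] this]]
    obtain N where N: "\<forall>m u. (times_z_minus_w ^^ N)
        (\<lambda>k n. mode V c k (supercommutator p a q b m n u)
          - vscale V ?k (supercommutator p a q b m n (mode V c k u))) = (\<lambda>k n. 0)"
      and N': "\<forall>j\<in>{..<J}. \<forall>u. (times_z_minus_w ^^ N)
        (\<lambda>k n. supercommutator r c (p + q) (mode V a (int j) b) k n u) = (\<lambda>k n. 0)"
      by (elim exE conjE) (rule that)
    define H where "H = (\<lambda>j k n. vscale V (of_nat (m choose j))
      (supercommutator r c (p + q) (mode V a (int j) b) k (n + (int m - int j)) (vac V)))"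
    have G: "mode V c k (G n (vac V)) - vscale V ?k (G n (mode V c k (vac V))) = (\<Sum>j<J. H j k n)"
      for k n
      by (simp add: G_def H_def supercommutator_def mode_sum_right scale_sum_right sum_subtractf
          mode_scale_right scale_right_diff_distrib algebra_simps)
    have H: "(times_z_minus_w ^^ N) (H j) k n = 0" if "j < J" for j k n
      unfolding H_def
      by (simp del: add_bit_eq_xor
          add: times_z_minus_w_power_map[where h = "vscale V l" for l] scale_right_diff_distrib
          times_z_minus_w_power_shift[where \<phi> = "\<lambda>k n. supercommutator r c p' x k n u" for p' x u]
          N' that)
    have "(\<lambda>k n. mode V c k (supercommutator p a q b (int m) n (vac V) - G n (vac V))
          - vscale V ?k (supercommutator p a q b (int m) n (mode V c k (vac V)) - G n (mode V c k (vac V))))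
        = (\<lambda>k n. (mode V c k (supercommutator p a q b (int m) n (vac V))
              - vscale V ?k (supercommutator p a q b (int m) n (mode V c k (vac V))))
            - (\<Sum>j<J. H j k n))"
      by (simp add: G[symmetric] mode_diff_right scale_right_diff_distrib algebra_simps)
    then have "(times_z_minus_w ^^ N)
        (\<lambda>k n. mode V c k (supercommutator p a q b (int m) n (vac V) - G n (vac V))
          - vscale V ?k (supercommutator p a q b (int m) n (mode V c k (vac V)) - G n (mode V c k (vac V))))
        = (\<lambda>k n. 0)"
      by (simp only: times_z_minus_w_power_diff[where \<psi> = "\<lambda>k n. \<Sum>j<J. H j k n"] N
          times_z_minus_w_power_sum)
        (simp add: H)
    then show "\<exists>N k. k \<noteq> 0 \<and> (times_z_minus_w ^^ N)
        (\<lambda>m' n. mode V c m' (supercommutator p a q b (int m) n (vac V) - G n (vac V))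
          - vscale V k (supercommutator p a q b (int m) n (mode V c m' (vac V))
              - G n (mode V c m' (vac V)))) = (\<lambda>m n. 0)"
      using koszul_sign_nonzero by blast
  qed
  then show ?thesis
    by (simp add: G_def)
qed

text \<open>
  The distributions \<open>g(w) \<partial>\<^sub>w\<^sup>j \<delta>(z - w) / j!\<close>: multiplication by \<open>z - w\<close> lowers \<open>j\<close> by one.
\<close>

lemma times_z_minus_w_power_gbinomial:
  assumes "j < N"
  shows "(times_z_minus_w ^^ N) (\<lambda>m n. vscale V (of_int m gchoose j) (g (m + n - int j))) = (\<lambda>m n. 0)"
proof -
  have "(times_z_minus_w ^^ Suc j) (\<lambda>m n. vscale V (of_int m gchoose j) (g (m + n - int j))) = (\<lambda>m n. 0)"
  proof (induction j)
    case 0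
    then show ?case
      by (simp add: times_z_minus_w_def algebra_simps)
  next
    case (Suc j)
    have "times_z_minus_w (\<lambda>m n. vscale V (of_int m gchoose Suc j) (g (m + n - int (Suc j))))
        = (\<lambda>m n. vscale V (of_int m gchoose j) (g (m + n - int j)))"
    proof (intro ext)
      fix m n
      have "m + 1 + n - int (Suc j) = m + n - int j" "m + (n + 1) - int (Suc j) = m + n - int j"
        by simp_all
      then show "times_z_minus_w (\<lambda>m n. vscale V (of_int m gchoose Suc j) (g (m + n - int (Suc j)))) m n
          = vscale V (of_int m gchoose j) (g (m + n - int j))"
        by (simp only: times_z_minus_w_def of_int_add of_int_1 gbinomial_Suc_Suc scale_left_distrib
            add_diff_cancel_right')
    qed
    then show ?case
      by (simp only: funpow_Suc_right[of "Suc j"] comp_apply Suc)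
  qed
  then show ?thesis
    by (rule times_z_minus_w_power_mono) (use assms in simp)
qed

text \<open>
  Both sides are killed by a power of \<open>z - w\<close> and agree for \<open>m \<ge> 0\<close>, so they agree for all \<open>m\<close>.
\<close>

theorem commutator_formula:
  assumes a: "a \<in> vpart V p" and b: "b \<in> vpart V q"
    and J: "\<forall>j\<ge>J. mode V a (int j) b = 0"
  shows "supercommutator p a q b m n c
    = (\<Sum>j<J. vscale V (of_int m gchoose j) (mode V (mode V a (int j) b) (m + n - int j) c))"
proof -
  define t where "t = (\<lambda>j m n.
    vscale V (of_int m gchoose j) (mode V (mode V a (int j) b) (m + n - int j) c))"
  obtain N where N: "N \<ge> J" "\<And>c. (times_z_minus_w ^^ N) (\<lambda>m n. supercommutator p a q b m n c) = (\<lambda>m n. 0)"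
    using eventually_happens'[OF _ eventually_conj[OF eventually_ge_at_top[of J]
          supercommutator_locality[OF a b]]] by auto
  have "supercommutator p a q b m n c - (\<Sum>j<J. t j m n) \<in> {0}"
  proof (rule times_z_minus_w_divide[where N = N and m\<^sub>0 = 0
        and \<phi> = "\<lambda>m n. supercommutator p a q b m n c - (\<Sum>j<J. t j m n)"])
    have "(times_z_minus_w ^^ N) (t j) = (\<lambda>m n. 0)" if "j < J" for j
      unfolding t_def using that N(1) by (intro times_z_minus_w_power_gbinomial) auto
    then show "(times_z_minus_w ^^ N) (\<lambda>m n. supercommutator p a q b m n c - (\<Sum>j<J. t j m n)) m n \<in> {0}"
      for m n
      by (simp add: times_z_minus_w_power_diff times_z_minus_w_power_sum N(2))
    show "supercommutator p a q b m n c - (\<Sum>j<J. t j m n) \<in> {0}" if "m \<ge> 0" for m n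
      using commutator_formula_nonneg[OF a b J, where m = "nat m" and n = n and c = c] that
      by (simp add: t_def binomial_gbinomial)
  qed auto
  then show ?thesis
    by (simp add: t_def)
qed

lemma mode_vac_eq_transl_power:
  "mode V x (-1 - int k) (vac V) = vscale V (1 / fact k) ((transl V ^^ k) x)"
proof (induction k)
  case 0
  then show ?case by (simp add: vac_right)
next
  case (Suc k)
  have "vscale V (of_nat (Suc k)) (mode V x (-1 - int (Suc k)) (vac V))
      = transl V (mode V x (-1 - int k) (vac V))"
  proof -
    have "- complex_of_int (-1 - int k) = of_nat (Suc k)" "-1 - int k - 1 = -1 - int (Suc k)"
      by simp_all
    then show ?thesis
      by (simp only: transl_mode_vac scale_minus_left[symmetric])
  qed
  also have "\<dots> = vscale V (of_nat (Suc k)) (vscale V (1 / fact (Suc k)) ((transl V ^^ Suc k) x))"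
  proof -
    have "of_nat (Suc k) * (1 / fact (Suc k)) = (1 / fact k :: complex)"
      unfolding fact_Suc by (simp del: of_nat_Suc)
    then show ?thesis
      by (simp only: Suc transl_scale scale_scale funpow.simps comp_apply)
  qed
  finally show ?case
    by (rule scale_left_imp_eq[rotated]) (simp del: of_nat_Suc)
qed

text \<open>
  This is the commutator formula for \<open>[b\<^sub>(\<^sub>-\<^sub>1\<^sub>), a\<^sub>(\<^sub>n\<^sub>)] 1\<close>: as \<open>a\<^sub>(\<^sub>n\<^sub>) 1 = 0\<close> and \<open>b\<^sub>(\<^sub>-\<^sub>1\<^sub>) 1 = b\<close>, its left-hand side
  is \<open>a\<^sub>(\<^sub>n\<^sub>) b\<close> up to sign, and \<open>x\<^sub>(\<^sub>-\<^sub>1\<^sub>-\<^sub>k\<^sub>) 1 = T\<^sup>k x / k!\<close>.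
\<close>

theorem skew_symmetry:
  assumes a: "a \<in> vpart V p" and b: "b \<in> vpart V q"
    and J: "\<forall>j\<ge>J. mode V b (int j) a = 0"
  shows "mode V a (int n) b = - vscale V (koszul_sign p q)
    (\<Sum>j\<in>{n..<J}. vscale V ((-1) ^ j / fact (j - n)) ((transl V ^^ (j - n)) (mode V b (int j) a)))"
proof -
  let ?t = "\<lambda>j. vscale V ((-1) ^ j) (mode V (mode V b (int j) a) (int n - 1 - int j) (vac V))"
  have "((-1 :: complex) gchoose j) = (-1) ^ j" for j
    using gbinomial_minus[of "1 :: complex" j] by (simp add: binomial_gbinomial[symmetric])
  then have "- vscale V (koszul_sign p q) (mode V a (int n) b) = (\<Sum>j<J. ?t j)"
    using commutator_formula[OF b a J, where m = "-1" and n = "int n" and c = "vac V"]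
    by (simp add: supercommutator_def vac_right koszul_sign_commute[of q p])
  also have "\<dots> = (\<Sum>j\<in>{n..<J}. ?t j)"
    by (rule sum.mono_neutral_right) (auto simp: vac_right(2))
  also have "\<dots> = (\<Sum>j\<in>{n..<J}. vscale V ((-1) ^ j / fact (j - n))
      ((transl V ^^ (j - n)) (mode V b (int j) a)))"
  proof (rule sum.cong)
    fix j assume "j \<in> {n..<J}"
    then have "int n - 1 - int j = -1 - int (j - n)"
      by simp
    then show "?t j = vscale V ((-1) ^ j / fact (j - n)) ((transl V ^^ (j - n)) (mode V b (int j) a))"
      by (simp only: mode_vac_eq_transl_power) simp
  qed simp
  finally have sum: "- vscale V (koszul_sign p q) (mode V a (int n) b)
      = (\<Sum>j\<in>{n..<J}. vscale V ((-1) ^ j / fact (j - n))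
          ((transl V ^^ (j - n)) (mode V b (int j) a)))" .
  show ?thesis
    unfolding sum[symmetric] by simp
qed

lemma mode_bound: "\<exists>J. \<forall>j\<ge>J. mode V a (int j) b = 0"
proof -
  obtain N where "\<forall>n\<ge>N. mode V a n b = 0"
    using field by blast
  then show ?thesis
    by (intro exI[of _ "nat N"]) auto
qed

section \<open>The largest ideal inside a subspace\<close>

lemma transl_power_in:
  assumes "transl V ` I \<subseteq> I" "x \<in> I"
  shows "(transl V ^^ k) x \<in> I"
  using assms by (induction k) auto

lemma graded_components:
  assumes "graded_subspace V I" "x\<^sub>0 \<in> vpart V 0" "x\<^sub>1 \<in> vpart V 1" "x\<^sub>0 + x\<^sub>1 \<in> I"
  shows "x\<^sub>0 \<in> I" "x\<^sub>1 \<in> I"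
proof -
  obtain y\<^sub>0 y\<^sub>1 where y: "y\<^sub>0 \<in> I \<inter> vpart V 0" "y\<^sub>1 \<in> I \<inter> vpart V 1" "x\<^sub>0 + x\<^sub>1 = y\<^sub>0 + y\<^sub>1"
    using assms(1,4) unfolding graded_subspace_def by blast
  have "x\<^sub>0 - y\<^sub>0 = y\<^sub>1 - x\<^sub>1"
    using y(3) by (simp add: algebra_simps)
  moreover have "x\<^sub>0 - y\<^sub>0 \<in> vpart V 0" "y\<^sub>1 - x\<^sub>1 \<in> vpart V 1"
    using y assms by (auto intro: subspace_diff part_subspace)
  ultimately have "x\<^sub>0 - y\<^sub>0 \<in> vpart V 0 \<inter> vpart V 1"
    by simp
  then have "x\<^sub>0 = y\<^sub>0"
    using part_disjoint by auto
  then show "x\<^sub>0 \<in> I" "x\<^sub>1 \<in> I"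
    using y by auto
qed

lemma graded_subspaceI:
  assumes "subspace I"
    and "\<And>x\<^sub>0 x\<^sub>1. x\<^sub>0 \<in> vpart V 0 \<Longrightarrow> x\<^sub>1 \<in> vpart V 1 \<Longrightarrow> x\<^sub>0 + x\<^sub>1 \<in> I \<Longrightarrow> x\<^sub>0 \<in> I \<and> x\<^sub>1 \<in> I"
  shows "graded_subspace V I"
  unfolding graded_subspace_def
proof (intro conjI ballI)
  fix x assume "x \<in> I"
  moreover obtain x\<^sub>0 x\<^sub>1 where "x\<^sub>0 \<in> vpart V 0" "x\<^sub>1 \<in> vpart V 1" "x = x\<^sub>0 + x\<^sub>1"
    using part_sum by blast
  ultimately show "\<exists>x\<^sub>0\<in>I \<inter> vpart V 0. \<exists>x\<^sub>1\<in>I \<inter> vpart V 1. x = x\<^sub>0 + x\<^sub>1"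
    using assms(2) by blast
qed (fact assms(1))

lemma graded_subspace_imp_subspace: "graded_subspace V I \<Longrightarrow> subspace I"
  by (simp add: graded_subspace_def)

lemma graded_subspace_induct [consumes 2, case_names homogeneous subspace]:
  assumes "graded_subspace V I" "x \<in> I"
    and "\<And>p x. x \<in> I \<Longrightarrow> x \<in> vpart V p \<Longrightarrow> x \<in> K" "subspace K"
  shows "x \<in> K"
proof -
  obtain x\<^sub>0 x\<^sub>1 where "x\<^sub>0 \<in> I \<inter> vpart V 0" "x\<^sub>1 \<in> I \<inter> vpart V 1" "x = x\<^sub>0 + x\<^sub>1"
    using assms(1,2) unfolding graded_subspace_def by blast
  then show ?thesis
    using assms(3,4) by (auto intro: subspace_add)
qed

lemma homogeneous_subspace_induct:
  assumes "subspace K" "\<And>p x. x \<in> vpart V p \<Longrightarrow> f x \<in> K" "\<And>x y. f (x + y) = f x + f y"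
  shows "f x \<in> K"
  by (rule homogeneous_induct[where x = x and P = "\<lambda>x. f x \<in> K"])
    (use assms in \<open>auto intro: subspace_add\<close>)

text \<open>
  For homogeneous \<open>c\<close>, the images of the even and the odd part of \<open>x\<close> under \<open>c\<^sub>(\<^sub>n\<^sub>)\<close> have different
  parities, so \<open>I\<close> contains both as soon as it contains their sum.
\<close>

lemma graded_transporter:
  assumes I: "graded_subspace V I"
  shows "graded_subspace V {x. \<forall>c. \<forall>n\<in>M. mode V c n x \<in> I}"
proof (rule graded_subspaceI)
  note sub = graded_subspace_imp_subspace[OF I]
  show "subspace {x. \<forall>c. \<forall>n\<in>M. mode V c n x \<in> I}"
    using sub by (auto intro!: subspaceI
        simp: mode_add_right mode_scale_right subspace_0 subspace_add subspace_scale)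
  fix x\<^sub>0 x\<^sub>1
  assume x: "x\<^sub>0 \<in> vpart V 0" "x\<^sub>1 \<in> vpart V 1" "x\<^sub>0 + x\<^sub>1 \<in> {x. \<forall>c. \<forall>n\<in>M. mode V c n x \<in> I}"
  have "mode V c n x\<^sub>0 \<in> I \<and> mode V c n x\<^sub>1 \<in> I" if c: "c \<in> vpart V r" and "n \<in> M" for c r n
  proof -
    have sum: "mode V c n x\<^sub>0 + mode V c n x\<^sub>1 \<in> I"
      using x(3) that by (simp add: mode_add_right)
    show ?thesis
    proof (cases r rule: bit.exhaust)
      case zero
      with graded_components[OF I _ _ sum] mode_parity[OF c x(1), of n] mode_parity[OF c x(2), of n]
      show ?thesis by simp
    next
      case one
      with graded_components[OF I _ _ sum[unfolded add.commute[of "mode V c n x\<^sub>0"]]]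
        mode_parity[OF c x(1), of n] mode_parity[OF c x(2), of n]
      show ?thesis by simp
    qed
  qed
  then show "x\<^sub>0 \<in> {x. \<forall>c. \<forall>n\<in>M. mode V c n x \<in> I} \<and> x\<^sub>1 \<in> {x. \<forall>c. \<forall>n\<in>M. mode V c n x \<in> I}"
    using homogeneous_subspace_induct[OF sub, of "\<lambda>c. mode V c n x" for n x]
    by (simp add: mode_add_left)
qed

lemma times_z_minus_w_power_in:
  assumes "subspace I" "\<And>m n. \<phi> m n \<in> I"
  shows "(times_z_minus_w ^^ N) \<phi> m n \<in> I"
  using assms(2)
  by (induction N arbitrary: m n) (auto simp: times_z_minus_w_def intro: subspace_diff[OF assms(1)])

text \<open>
  If \<open>a(z) b(w) u\<close> has its coefficients in \<open>I\<close>, then by locality so has \<open>(z - w)\<^sup>N b(w) a(z) u\<close>, and the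
  factor \<open>(z - w)\<^sup>N\<close> can be divided out because \<open>a\<^sub>(\<^sub>m\<^sub>) u = 0\<close> for large \<open>m\<close>.
\<close>

lemma reorder_modes:
  assumes I: "subspace I" and a: "a \<in> vpart V p" and b: "b \<in> vpart V q"
    and "\<And>m n. mode V a m (mode V b n u) \<in> I"
  shows "mode V b n (mode V a m u) \<in> I"
proof -
  let ?k = "koszul_sign p q"
  obtain N where N: "(times_z_minus_w ^^ N) (\<lambda>m n. supercommutator p a q b m n u) = (\<lambda>m n. 0)"
    using eventually_happens'[OF _ supercommutator_locality[OF a b]] by auto
  obtain M where M: "\<And>m. m \<ge> M \<Longrightarrow> mode V a m u = 0"
    using field by blast
  have "vscale V ?k (mode V b n (mode V a m u)) \<in> I"
  proof (rule times_z_minus_w_divide[where N = N and m\<^sub>0 = M and I = I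
        and \<phi> = "\<lambda>m n. vscale V ?k (mode V b n (mode V a m u))"])
    show "(times_z_minus_w ^^ N) (\<lambda>m n. vscale V ?k (mode V b n (mode V a m u))) m n \<in> I" for m n
    proof -
      have "(times_z_minus_w ^^ N) (\<lambda>m n. vscale V ?k (mode V b n (mode V a m u)))
          = (times_z_minus_w ^^ N) (\<lambda>m n. mode V a m (mode V b n u))"
        using N by (simp add: supercommutator_def times_z_minus_w_power_diff fun_eq_iff)
      then show ?thesis
        by (simp add: times_z_minus_w_power_in I assms(4))
    qed
  qed (use I in \<open>auto simp: M intro: subspace_diff subspace_0\<close>)
  then have "vscale V ?k (vscale V ?k (mode V b n (mode V a m u))) \<in> I"
    using I by (rule subspace_scale[rotated])
  then show ?thesis
    by simp
qed

text \<open>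
  When \<open>I\<close> is graded and \<open>T\<close>-stable this is the largest vertex ideal contained in \<open>I\<close>.  The definition
  asks for a single application of a mode; that more of them do not lead out of \<open>I\<close> is a theorem.
\<close>

definition vertex_core :: "'v set \<Rightarrow> 'v set" where
  "vertex_core I = {x. \<forall>c n. mode V c n x \<in> I}"

lemma vertex_core_subset: "vertex_core I \<subseteq> I"
proof
  fix x assume "x \<in> vertex_core I"
  then have "mode V (vac V) (-1) x \<in> I"
    unfolding vertex_core_def by blast
  then show "x \<in> I"
    by (simp add: vac_left)
qed

lemma subspace_vertex_core:
  assumes "subspace I"
  shows "subspace (vertex_core I)"
  using assms unfolding vertex_core_def
  by (auto intro!: subspaceI simp: mode_add_right mode_scale_right subspace_0 subspace_add subspace_scale)

lemma graded_vertex_core: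
  assumes "graded_subspace V I"
  shows "graded_subspace V (vertex_core I)"
  unfolding vertex_core_def using graded_transporter[OF assms, of UNIV] by simp

lemma mode_in_vertex_core:
  assumes I: "subspace I" and x: "x \<in> vpart V p" and "\<And>n c. mode V x n c \<in> I"
  shows "mode V x m u \<in> vertex_core I"
proof -
  have "mode V c n (mode V x m u) \<in> I" if "c \<in> vpart V q" for c q n
    using that assms by (intro reorder_modes[OF I x])
  then show ?thesis
    unfolding vertex_core_def
    using homogeneous_subspace_induct[OF I, of "\<lambda>c. mode V c n (mode V x m u)" for n]
    by (simp add: mode_add_left)
qed

lemma transl_vertex_core:
  assumes "subspace I" "transl V ` I \<subseteq> I"
  shows "transl V ` vertex_core I \<subseteq> vertex_core I"
  using assms(2) unfolding vertex_core_def
  by (auto simp: mode_transl image_subset_iff intro!: subspace_add subspace_scale assms(1))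

text \<open>
  Left and right modes can be exchanged in the definition of the core: write \<open>x\<^sub>(\<^sub>n\<^sub>) c = x\<^sub>(\<^sub>n\<^sub>) c\<^sub>(\<^sub>-\<^sub>1\<^sub>) 1\<close> and move
  \<open>x\<close> past \<open>c\<close>, where the vectors \<open>x\<^sub>(\<^sub>n\<^sub>) 1\<close> are multiples of the \<open>T\<^sup>k x\<close>.
\<close>

lemma vertex_core_left:
  assumes I: "subspace I" "transl V ` I \<subseteq> I" and x: "x \<in> vpart V p" "x \<in> vertex_core I"
  shows "mode V x n c \<in> I"
proof (rule homogeneous_subspace_induct[OF I(1), of "\<lambda>c. mode V x n c"])
  fix c q assume c: "c \<in> vpart V q"
  have x': "mode V x n (vac V) \<in> vertex_core I" for n
  proof (cases "n \<ge> 0")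
    case True
    then show ?thesis
      by (simp add: vac_right(2) subspace_0 subspace_vertex_core I)
  next
    case False
    then have "n = -1 - int (nat (- n - 1))"
      by simp
    then show ?thesis
      using mode_vac_eq_transl_power[of x "nat (- n - 1)"]
      by (simp add: transl_power_in transl_vertex_core subspace_vertex_core subspace_scale I x)
  qed
  have "mode V x n (mode V c (-1) (vac V)) \<in> I"
    by (rule reorder_modes[OF I(1) c x(1)]) (use x' in \<open>auto simp: vertex_core_def\<close>)
  then show "mode V x n c \<in> I"
    by (simp add: vac_right)
qed (simp add: mode_add_right)

text \<open>
  If \<open>x\<close> is in the core, then all \<open>x\<^sub>(\<^sub>m\<^sub>) u\<close> are, by reordering inside \<open>I\<close>.  The same step with the core in
  place of \<open>I\<close>, applied to \<open>x = x\<^sub>(\<^sub>-\<^sub>1\<^sub>) 1\<close>, shows that all \<open>c\<^sub>(\<^sub>n\<^sub>) x\<close> are in the core.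
\<close>

theorem vertex_ideal_vertex_core:
  assumes I: "graded_subspace V I" "transl V ` I \<subseteq> I"
  shows "vertex_ideal V (vertex_core I)"
proof -
  note sub = graded_subspace_imp_subspace[OF I(1)]
  note core = subspace_vertex_core[OF sub]
  have "mode V c n x \<in> vertex_core I" if "x \<in> vertex_core I" for c n x
  proof -
    have "x \<in> {x. \<forall>c n. mode V c n x \<in> vertex_core I}"
      using graded_vertex_core[OF I(1)] that
    proof (induction rule: graded_subspace_induct)
      case (homogeneous p x)
      have "mode V x m u \<in> vertex_core I" for m u
        using homogeneous(2)
        by (rule mode_in_vertex_core[OF sub])
          (use homogeneous I sub in \<open>auto intro: vertex_core_left\<close>)
      then have "mode V x (-1) (vac V) \<in> vertex_core (vertex_core I)"
        by (rule mode_in_vertex_core[OF core homogeneous(2)])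
      then show ?case
        by (simp add: vertex_core_def vac_right)
    next
      case subspace
      show ?case
        using core by (auto intro!: subspaceI
            simp: mode_add_right mode_scale_right subspace_0 subspace_add subspace_scale)
    qed
    then show ?thesis by blast
  qed
  then have "vertex_product V UNIV (vertex_core I) \<subseteq> vertex_core I"
    unfolding vertex_product_def using core by (intro span_minimal) auto
  then show ?thesis
    unfolding vertex_ideal_def
    using graded_vertex_core[OF I(1)] transl_vertex_core[OF sub I(2)] by blast
qed

lemma simple_vertex_core:
  assumes "simple_vertex V" "graded_subspace V I" "transl V ` I \<subseteq> I"
  shows "vertex_core I = {0} \<or> I = UNIV"
proof -
  have "vertex_core I = {0} \<or> vertex_core I = UNIV"
    using assms vertex_ideal_vertex_core unfolding simple_vertex_def by blast
  then show ?thesis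
    using vertex_core_subset[of I] by auto
qed

section \<open>Lie ideals of a simple vertex superalgebra\<close>

text \<open>
  Taking differences in \<open>m\<close> lowers all the binomial coefficients and removes \<open>x 0\<close>.
\<close>

lemma binomial_combinations_in:
  assumes "subspace I"
    and "\<And>m. m \<ge> M \<Longrightarrow> (\<Sum>j<J. vscale V (of_nat (m choose j)) (x j)) \<in> I"
    and "j < J"
  shows "x j \<in> I"
  using assms(2,3)
proof (induction J arbitrary: x j)
  case (Suc J)
  have shift: "x (Suc i) \<in> I" if "i < J" for i
  proof (rule Suc.IH[where x = "\<lambda>i. x (Suc i)", OF _ that])
    fix m assume "m \<ge> M"
    then have "(\<Sum>j<Suc J. vscale V (of_nat (Suc m choose j)) (x j))
        - (\<Sum>j<Suc J. vscale V (of_nat (m choose j)) (x j)) \<in> I"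
      using Suc.prems(1)[of m] Suc.prems(1)[of "Suc m"] assms(1) by (intro subspace_diff) auto
    moreover have "(\<Sum>j<Suc J. vscale V (of_nat (Suc m choose j)) (x j))
        - (\<Sum>j<Suc J. vscale V (of_nat (m choose j)) (x j))
        = (\<Sum>j<J. vscale V (of_nat (m choose j)) (x (Suc j)))"
      by (simp add: sum.lessThan_Suc_shift scale_left_distrib sum.distrib del: sum.lessThan_Suc)
    ultimately show "(\<Sum>j<J. vscale V (of_nat (m choose j)) (x (Suc j))) \<in> I"
      by simp
  qed
  have "(\<Sum>j<J. vscale V (of_nat (M choose Suc j)) (x (Suc j))) \<in> I"
    using shift assms(1) by (intro subspace_sum subspace_scale) auto
  then have "(\<Sum>j<Suc J. vscale V (of_nat (M choose j)) (x j))
      - (\<Sum>j<J. vscale V (of_nat (M choose Suc j)) (x (Suc j))) \<in> I"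
    by (rule subspace_diff[OF assms(1) Suc.prems(1)[OF order_refl]])
  then have "x 0 \<in> I"
    by (simp add: sum.lessThan_Suc_shift del: sum.lessThan_Suc)
  then show ?case
    using shift Suc.prems(2) by (metis Suc_less_eq not0_implies_Suc)
qed simp

text \<open>
  If \<open>a\<^sub>(\<^sub>m\<^sub>)\<close> maps into \<open>I\<close> for all \<open>m \<ge> 0\<close>, then so does every mode of \<open>a\<^sub>(\<^sub>j\<^sub>) b\<close>, also those of negative
  index.  In the commutator formula for \<open>a\<^sub>(\<^sub>m\<^sub>) b\<^sub>(\<^sub>s\<^sub>-\<^sub>m\<^sub>) c\<close> the term \<open>b\<^sub>(\<^sub>s\<^sub>-\<^sub>m\<^sub>) a\<^sub>(\<^sub>m\<^sub>) c\<close> vanishes for large \<open>m\<close>, while the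
  right-hand side is a combination of the vectors \<open>(a\<^sub>(\<^sub>j\<^sub>) b)\<^sub>(\<^sub>s\<^sub>-\<^sub>j\<^sub>) c\<close>, which do not depend on \<open>m\<close>; only their
  binomial coefficients do.
\<close>

lemma bracket_modes_in:
  assumes I: "subspace I" and a: "a \<in> vpart V p" and aI: "\<And>n x. mode V a (int n) x \<in> I"
  shows "mode V (mode V a (int j) b) k c \<in> I"
proof (rule homogeneous_subspace_induct[OF I, of "\<lambda>b. mode V (mode V a (int j) b) k c"])
  fix b q assume b: "b \<in> vpart V q"
  obtain J where J: "\<forall>j\<ge>J. mode V a (int j) b = 0"
    using mode_bound by blast
  obtain M where M: "\<And>m. m \<ge> M \<Longrightarrow> mode V a (int m) c = 0"
    using mode_bound by blast
  \<comment> \<open>the sum of the two indices, which is the same for all \<open>j\<close> in the commutator formula\<close>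
  define s where "s = k + int j"
  show "mode V (mode V a (int j) b) k c \<in> I"
  proof (cases "j < J")
    case True
    have "mode V (mode V a (int j) b) (s - int j) c \<in> I"
    proof (rule binomial_combinations_in[OF I, where M = M and J = J
          and x = "\<lambda>j. mode V (mode V a (int j) b) (s - int j) c"])
      fix m assume "m \<ge> M"
      have "(\<Sum>j<J. vscale V (of_nat (m choose j)) (mode V (mode V a (int j) b) (s - int j) c))
          = supercommutator p a q b (int m) (s - int m) c"
        by (simp add: commutator_formula_nonneg[OF a b J])
      also have "\<dots> = mode V a (int m) (mode V b (s - int m) c)"
        by (simp add: supercommutator_def M \<open>m \<ge> M\<close>)
      finally show "(\<Sum>j<J. vscale V (of_nat (m choose j)) (mode V (mode V a (int j) b) (s - int j) c)) \<in> I"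
        by (simp add: aI)
    qed (fact True)
    then show ?thesis
      by (simp add: s_def)
  next
    case False
    then show ?thesis
      by (simp add: J subspace_0 I)
  qed
qed (simp add: mode_add_left mode_add_right)

lemma bracket_in_vertex_core:
  assumes I: "subspace I" and a: "a \<in> vpart V p" and aI: "\<And>n x. mode V a (int n) x \<in> I"
  shows "mode V a (int j) b \<in> vertex_core I"
proof (rule homogeneous_subspace_induct[OF subspace_vertex_core[OF I], of "\<lambda>b. mode V a (int j) b"])
  fix b q assume b: "b \<in> vpart V q"
  have "mode V (mode V a (int j) b) (-1) (vac V) \<in> vertex_core I"
    by (rule mode_in_vertex_core[OF I mode_parity[OF a b]]) (rule bracket_modes_in[OF I a aI])
  then show "mode V a (int j) b \<in> vertex_core I"
    by (simp add: vac_right)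
qed (simp add: mode_add_right)

lemma right_Lie_ideal:
  assumes I: "subspace I" "transl V ` I \<subseteq> I" and ideal: "\<And>c n x. x \<in> I \<Longrightarrow> mode V c (int n) x \<in> I"
    and a: "a \<in> vpart V p" "a \<in> I"
  shows "mode V a (int n) b \<in> I"
proof (rule homogeneous_subspace_induct[OF I(1), of "\<lambda>b. mode V a (int n) b"])
  fix b q assume b: "b \<in> vpart V q"
  obtain J where J: "\<forall>j\<ge>J. mode V b (int j) a = 0"
    using mode_bound by blast
  show "mode V a (int n) b \<in> I"
    unfolding skew_symmetry[OF a(1) b J]
    by (intro subspace_neg subspace_scale subspace_sum transl_power_in ideal I a(2))
qed (simp add: mode_add_right)

text \<open>
  All brackets of elements of \<open>I\<close> lie in the core of \<open>I\<close>, which is \<open>0\<close> unless \<open>I\<close> is everything.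
\<close>

theorem simple_Lie_ideal:
  assumes simple: "simple_vertex V" and I: "graded_subspace V I" "transl V ` I \<subseteq> I"
    and ideal: "\<And>c n x. x \<in> I \<Longrightarrow> mode V c (int n) x \<in> I"
  shows "I = UNIV \<or> (\<forall>x\<in>I. \<forall>c n. mode V c (int n) x = 0)"
proof (cases "vertex_core I = {0}")
  case True
  note sub = graded_subspace_imp_subspace[OF I(1)]
  have "x \<in> {x. \<forall>c n. mode V c (int n) x \<in> {0}}" if "x \<in> I" for x
    using I(1) that
  proof (induction rule: graded_subspace_induct)
    case (homogeneous p x)
    have left: "mode V x (int n) c = 0" for n c
      using bracket_in_vertex_core[OF sub homogeneous(2) right_Lie_ideal[OF sub I(2) ideal homogeneous(2,1)]]
        True by auto
    have "mode V c (int n) x \<in> {0}" for c n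
    proof (rule homogeneous_subspace_induct[OF subspace_single_0, of "\<lambda>c. mode V c (int n) x"])
      fix c q assume c: "c \<in> vpart V q"
      show "mode V c (int n) x \<in> {0}"
        using skew_symmetry[OF c homogeneous(2), of 0 n] left by simp
    qed (simp add: mode_add_left)
    then show ?case by blast
  next
    case subspace
    then show ?case
      by (auto intro!: subspaceI simp: mode_add_right mode_scale_right)
  qed
  then show ?thesis by auto
qed (use simple_vertex_core[OF simple I] in blast)

text \<open>
  Here every homogeneous vector maps into \<open>I\<close> by its modes of nonnegative index, so the core of \<open>I\<close>
  contains all brackets.
\<close>

theorem simple_derived:
  assumes simple: "simple_vertex V" and I: "graded_subspace V I" "transl V ` I \<subseteq> I"
    and derived: "\<And>a n b. mode V a (int n) b \<in> I"
  shows "I = UNIV \<or> (\<forall>a n b. mode V a (int n) b = 0)"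
proof (cases "vertex_core I = {0}")
  case True
  have "mode V a (int n) b \<in> {0}" for a n b
    by (rule homogeneous_subspace_induct[OF subspace_single_0, of "\<lambda>a. mode V a (int n) b"])
      (use bracket_in_vertex_core[OF graded_subspace_imp_subspace[OF I(1)] _ derived] True
        in \<open>auto simp: mode_add_left\<close>)
  then show ?thesis by auto
qed (use simple_vertex_core[OF simple I] in blast)

end

section \<open>Quotients of Lie conformal superalgebras\<close>

lemma complex_ring_simps [simp]:
  "carrier complex_ring = UNIV" "x \<oplus>\<^bsub>complex_ring\<^esub> y = x + y" "x \<otimes>\<^bsub>complex_ring\<^esub> y = x * y"
  "\<zero>\<^bsub>complex_ring\<^esub> = 0" "\<one>\<^bsub>complex_ring\<^esub> = 1"
  by (simp_all add: ring_of_type_algebra_def)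

lemma submodule_zero_closed:
  assumes "submodule U A M"
  shows "\<zero>\<^bsub>M\<^esub> \<in> U"
  using subgroup.one_closed[OF submodule.axioms(1)[OF assms]] by simp

lemma bracket_span_subset_iff:
  assumes "submodule U complex_ring R"
  shows "bracket_span R A B \<subseteq> U \<longleftrightarrow> (\<forall>a\<in>A. \<forall>b\<in>B. \<forall>n. lbracket R a b n \<in> U)"
  unfolding bracket_span_def subset_hull[of "\<lambda>U. submodule U complex_ring R" U, OF assms] by auto

lemma (in module) submodule_Inter:
  assumes "\<And>U. U \<in> \<U> \<Longrightarrow> submodule U R M" "\<U> \<noteq> {}"
  shows "submodule (\<Inter>\<U>) R M"
proof (rule submoduleI)
  show "\<Inter>\<U> \<subseteq> carrier M"
    using assms submoduleE(1) by blast
qed (use assms in \<open>auto simp: submoduleE(3-5) dest: submodule_zero_closed\<close>)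

context lie_conformal_superalgebra
begin

lemma submodule_bracket_span:
  assumes "A \<subseteq> carrier R" "B \<subseteq> carrier R"
  shows "submodule (bracket_span R A B) complex_ring R"
  unfolding bracket_span_def hull_def
proof (rule submodule_Inter)
  show "{t. submodule t complex_ring R \<and> {lbracket R a b n | a b n. a \<in> A \<and> b \<in> B} \<subseteq> t} \<noteq> {}"
    using carrier_is_submodule bracket_closed assms by blast
qed auto

lemma bracket_span_eq_zero_iff:
  "bracket_span R A B = {\<zero>} \<longleftrightarrow> (\<forall>a\<in>A. \<forall>b\<in>B. \<forall>n. lbracket R a b n = \<zero>)"
proof -
  have "submodule {\<zero>} complex_ring R"
    by (rule submoduleI) auto
  moreover have "\<zero> \<in> bracket_span R A B"
    unfolding bracket_span_def hull_def using submodule_zero_closed by auto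
  ultimately show ?thesis
    using bracket_span_subset_iff[of "{\<zero>}" R A B] by auto
qed

lemma part_closed: "x \<in> part R p \<Longrightarrow> x \<in> carrier R"
  using submoduleE(1)[OF part_submodule] by blast

lemma part_decompose:
  assumes "x \<in> carrier R"
  obtains x\<^sub>0 x\<^sub>1 where "x\<^sub>0 \<in> part R 0" "x\<^sub>1 \<in> part R 1" "x = x\<^sub>0 \<oplus> x\<^sub>1"
  using assms unfolding part_sum set_add_def' by blast

lemma graded_submodule_components:
  assumes "graded_submodule R U" "x\<^sub>0 \<in> part R 0" "x\<^sub>1 \<in> part R 1" "x\<^sub>0 \<oplus> x\<^sub>1 \<in> U"
  shows "x\<^sub>0 \<in> U" "x\<^sub>1 \<in> U"
proof -
  obtain y\<^sub>0 y\<^sub>1 where y: "y\<^sub>0 \<in> U \<inter> part R 0" "y\<^sub>1 \<in> U \<inter> part R 1" "x\<^sub>0 \<oplus> x\<^sub>1 = y\<^sub>0 \<oplus> y\<^sub>1"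
    using assms(1,4) unfolding graded_submodule_def set_add_def' by blast
  have closed: "x\<^sub>0 \<in> carrier R" "x\<^sub>1 \<in> carrier R" "y\<^sub>0 \<in> carrier R" "y\<^sub>1 \<in> carrier R"
    using y assms part_closed by auto
  have "x\<^sub>0 \<ominus> y\<^sub>0 = (x\<^sub>0 \<oplus> x\<^sub>1) \<ominus> (y\<^sub>0 \<oplus> x\<^sub>1)"
    using closed by (simp add: M.minus_eq M.minus_add M.a_ac M.r_neg1 M.r_neg2)
  also have "\<dots> = y\<^sub>1 \<ominus> x\<^sub>1"
    unfolding y(3) M.a_comm[OF closed(3,4)]
    using closed by (simp add: M.minus_eq M.minus_add M.a_assoc M.r_neg2)
  finally have eq: "x\<^sub>0 \<ominus> y\<^sub>0 = y\<^sub>1 \<ominus> x\<^sub>1" .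
  have "x\<^sub>0 \<ominus> y\<^sub>0 \<in> part R 0" "y\<^sub>1 \<ominus> x\<^sub>1 \<in> part R 1"
    unfolding M.minus_eq using y assms by (auto intro!: submoduleE(3,5)[OF part_submodule])
  then have "x\<^sub>0 \<ominus> y\<^sub>0 = \<zero>"
    using part_disjoint unfolding eq by blast
  then have "x\<^sub>0 = y\<^sub>0"
    using closed M.minus_equality[of "x\<^sub>0" "\<ominus> y\<^sub>0"] by (simp add: M.minus_eq)
  then show "x\<^sub>0 \<in> U" "x\<^sub>1 \<in> U"
    using y closed by auto
qed

lemma graded_submoduleI:
  assumes "submodule U complex_ring R"
    and "\<And>x\<^sub>0 x\<^sub>1. x\<^sub>0 \<in> part R 0 \<Longrightarrow> x\<^sub>1 \<in> part R 1 \<Longrightarrow> x\<^sub>0 \<oplus> x\<^sub>1 \<in> U \<Longrightarrow> x\<^sub>0 \<in> U \<and> x\<^sub>1 \<in> U"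
  shows "graded_submodule R U"
  unfolding graded_submodule_def
proof (intro conjI equalityI subsetI)
  fix x assume x: "x \<in> U"
  then have "x \<in> carrier R"
    using submoduleE(1)[OF assms(1)] by blast
  then obtain x\<^sub>0 x\<^sub>1 where "x\<^sub>0 \<in> part R 0" "x\<^sub>1 \<in> part R 1" "x = x\<^sub>0 \<oplus> x\<^sub>1"
    by (rule part_decompose)
  then show "x \<in> set_add R (U \<inter> part R 0) (U \<inter> part R 1)"
    unfolding set_add_def' using assms(2) x by blast
next
  fix x assume "x \<in> set_add R (U \<inter> part R 0) (U \<inter> part R 1)"
  then show "x \<in> U"
    unfolding set_add_def' using submoduleE(5)[OF assms(1)] by blast
qed (fact assms(1))

lemma ideal_submodule: "lie_conformal_ideal R I \<Longrightarrow> submodule I complex_ring R"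
  by (simp add: lie_conformal_ideal_def graded_submodule_def)

lemma lie_conformal_ideal_iff:
  "lie_conformal_ideal R I \<longleftrightarrow> graded_submodule R I \<and> (\<forall>x\<in>I. der R x \<in> I) \<and>
     (\<forall>a\<in>carrier R. \<forall>x\<in>I. \<forall>n. lbracket R a x n \<in> I)"
  unfolding lie_conformal_ideal_def using bracket_span_subset_iff[of I R "carrier R" I]
  by (auto simp: graded_submodule_def)

lemma der_zero [simp]: "der R \<zero> = \<zero>"
  using der_smult[of \<zero> 0] smult_l_null[simplified] by (simp add: der_closed)

lemma neg_der_lambda_in:
  assumes U: "submodule U complex_ring R" "\<And>x. x \<in> U \<Longrightarrow> der R x \<in> U" and "\<And>n. P n \<in> U"
  shows "(neg_der_lambda R ^^ k) P n \<in> U"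
  using assms(3)
proof (induction k arbitrary: P n)
  case (Suc k)
  have "neg_der_lambda R P n \<in> U" for n
    unfolding neg_der_lambda_def times_lambda_def
    by (cases n) (simp_all add: submoduleE(3,5)[OF U(1)] U(2) Suc.prems submodule_zero_closed[OF U(1)])
  from Suc.IH[OF this] show ?case
    by (simp add: funpow_swap1)
qed simp

lemma const_poly_in:
  "submodule U complex_ring R \<Longrightarrow> x \<in> U \<Longrightarrow> const_poly R x n \<in> U"
  by (simp add: const_poly_def submodule_zero_closed)

lemma finsum_in:
  assumes U: "submodule U complex_ring R" and "\<And>i. i \<in> A \<Longrightarrow> g i \<in> U"
  shows "(\<Oplus>i\<in>A. g i) \<in> U"
  using assms(2)
proof (induction A rule: infinite_finite_induct)
  case (insert x F)
  then have "g \<in> F \<rightarrow> carrier R" "g x \<in> carrier R"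
    using submoduleE(1)[OF U] by auto
  then show ?case
    using insert by (simp add: M.finsum_insert submoduleE(5)[OF U])
qed (simp_all add: submodule_zero_closed[OF U])

lemma subst_neg_der_lambda_in:
  assumes "submodule U complex_ring R" "\<And>x. x \<in> U \<Longrightarrow> der R x \<in> U" "\<And>n. P n \<in> U"
  shows "subst_neg_der_lambda R P k \<in> U"
  unfolding subst_neg_der_lambda_def
  by (intro finsum_in neg_der_lambda_in const_poly_in assms)

text \<open>
  Skew-symmetry, with \<open>-\<partial> - \<lambda>\<close> substituted in a polynomial that has its coefficients in \<open>I\<close>.
\<close>

lemma ideal_bracket_left:
  assumes I: "lie_conformal_ideal R I" and x: "x \<in> I" and a: "a \<in> carrier R"
  shows "lbracket R x a n \<in> I"
proof -
  note sub = ideal_submodule[OF I]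
  have hom: "lbracket R x a n \<in> I" if "x \<in> part R p" "a \<in> part R q" "x \<in> I" for x a p q
    unfolding skew_symmetry[OF that(1,2)]
    using I that part_closed
    by (intro submoduleE(3)[OF sub] submoduleE(4)[OF sub] subst_neg_der_lambda_in[OF sub])
      (auto simp: lie_conformal_ideal_iff)
  have xc: "x \<in> carrier R"
    using submoduleE(1)[OF sub] x by blast
  obtain x\<^sub>0 x\<^sub>1 where x': "x\<^sub>0 \<in> part R 0" "x\<^sub>1 \<in> part R 1" "x = x\<^sub>0 \<oplus> x\<^sub>1"
    using xc by (rule part_decompose)
  obtain a\<^sub>0 a\<^sub>1 where a': "a\<^sub>0 \<in> part R 0" "a\<^sub>1 \<in> part R 1" "a = a\<^sub>0 \<oplus> a\<^sub>1"
    using a by (rule part_decompose)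
  have "x\<^sub>0 \<in> I" "x\<^sub>1 \<in> I"
    using graded_submodule_components[of I] I x x' by (auto simp: lie_conformal_ideal_iff)
  then show ?thesis
    using x' a' by (simp add: bracket_add_left bracket_add_right part_closed submoduleE(5)[OF sub] hom)
qed

end

text \<open>
  \<open>S\<close> is not assumed to be a Lie conformal superalgebra: it inherits the axioms along \<open>f\<close>.  Only the
  independence of its two homogeneous components has to be required, as it depends on the kernel.
\<close>

locale lie_conformal_epimorphism = R?: lie_conformal_superalgebra R
  for R :: "('a, 'm) lie_conformal_scheme"
    and S :: "('b, 'n) lie_conformal_scheme" and f :: "'a \<Rightarrow> 'b" +
  assumes carrier_image: "carrier S = f ` carrier R"
    and part_image: "part S p = f ` part R p"
    and part_disjoint_image: "part S 0 \<inter> part S 1 \<subseteq> {\<zero>\<^bsub>S\<^esub>}"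
    and map_zero: "f \<zero>\<^bsub>R\<^esub> = \<zero>\<^bsub>S\<^esub>"
    and map_add: "x \<in> carrier R \<Longrightarrow> y \<in> carrier R \<Longrightarrow> f (x \<oplus>\<^bsub>R\<^esub> y) = f x \<oplus>\<^bsub>S\<^esub> f y"
    and map_smult: "x \<in> carrier R \<Longrightarrow> f (k \<odot>\<^bsub>R\<^esub> x) = k \<odot>\<^bsub>S\<^esub> f x"
    and map_der: "x \<in> carrier R \<Longrightarrow> f (der R x) = der S (f x)"
    and map_bracket: "x \<in> carrier R \<Longrightarrow> y \<in> carrier R \<Longrightarrow> f (lbracket R x y n) = lbracket S (f x) (f y) n"
begin

lemma map_closed: "x \<in> carrier R \<Longrightarrow> f x \<in> carrier S"
  by (simp add: carrier_image)

lemma codomain_module: "module complex_ring S"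
proof (rule moduleI)
  show "cring complex_ring"
    by (rule cring_from_type_algebra)
  show "abelian_group S"
  proof (rule abelian_groupI)
    fix x assume "x \<in> carrier S"
    then obtain a where a: "a \<in> carrier R" "x = f a"
      by (auto simp: carrier_image)
    then have "f (\<ominus>\<^bsub>R\<^esub> a) \<oplus>\<^bsub>S\<^esub> x = \<zero>\<^bsub>S\<^esub>"
      by (simp add: R.M.l_neg flip: map_add map_zero)
    then show "\<exists>y\<in>carrier S. y \<oplus>\<^bsub>S\<^esub> x = \<zero>\<^bsub>S\<^esub>"
      using a by (auto intro: map_closed)
  qed (auto simp: carrier_image R.M.a_ac simp flip: map_add map_zero)
qed (auto simp: carrier_image R.smult_l_distr[simplified] R.smult_r_distr
      R.smult_assoc1[simplified] R.smult_one[simplified] simp flip: map_add map_smult)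

sublocale S: module complex_ring S
  by (rule codomain_module)

lemma map_minus:
  assumes "x \<in> carrier R"
  shows "f (\<ominus>\<^bsub>R\<^esub> x) = \<ominus>\<^bsub>S\<^esub> f x"
proof -
  have "f (\<ominus>\<^bsub>R\<^esub> x) \<oplus>\<^bsub>S\<^esub> f x = \<zero>\<^bsub>S\<^esub>"
    using assms by (simp add: R.M.l_neg map_zero flip: map_add)
  then show ?thesis
    using assms by (simp add: S.M.minus_equality map_closed)
qed

lemma map_diff: "x \<in> carrier R \<Longrightarrow> y \<in> carrier R \<Longrightarrow> f (x \<ominus>\<^bsub>R\<^esub> y) = f x \<ominus>\<^bsub>S\<^esub> f y"
  by (simp add: R.M.minus_eq S.M.minus_eq map_add map_minus)

lemma map_finsum:
  assumes "g \<in> A \<rightarrow> carrier R"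
  shows "f (\<Oplus>\<^bsub>R\<^esub>i\<in>A. g i) = (\<Oplus>\<^bsub>S\<^esub>i\<in>A. f (g i))"
  using assms
proof (induction A rule: infinite_finite_induct)
  case (insert x F)
  then have "g \<in> F \<rightarrow> carrier R" "g x \<in> carrier R" "(\<lambda>i. f (g i)) \<in> F \<rightarrow> carrier S" "f (g x) \<in> carrier S"
    by (auto intro: map_closed)
  then show ?case
    using insert by (simp add: R.M.finsum_insert S.M.finsum_insert map_add R.M.finsum_closed)
qed (simp_all add: map_zero)

lemma map_times_lambda: "f (times_lambda R P n) = times_lambda S (\<lambda>n. f (P n)) n"
  by (cases n) (simp_all add: times_lambda_def map_zero)

lemma map_neg_der_lambda:
  assumes "\<And>n. P n \<in> carrier R"
  shows "f ((neg_der_lambda R ^^ k) P n) = (neg_der_lambda S ^^ k) (\<lambda>n. f (P n)) n"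
  using assms
proof (induction k arbitrary: P n)
  case (Suc k)
  have closed: "neg_der_lambda R P n \<in> carrier R" for n
    using R.neg_der_lambda_in[OF R.carrier_is_submodule _ Suc.prems, where k = 1 and n = n] by (simp add: R.der_closed)
  have "f (neg_der_lambda R P n) = neg_der_lambda S (\<lambda>n. f (P n)) n" for n
  proof -
    have "times_lambda R P n \<in> carrier R"
      by (cases n) (simp_all add: times_lambda_def Suc.prems)
    then show ?thesis
      by (simp add: neg_der_lambda_def map_minus map_add map_der Suc.prems R.der_closed map_times_lambda)
  qed
  then show ?case
    using Suc.IH[OF closed] by (simp add: funpow_swap1)
qed simp

lemma finite_support_image:
  assumes "finite {n. P n \<noteq> \<zero>\<^bsub>R\<^esub>}"
  shows "finite {n. f (P n) \<noteq> \<zero>\<^bsub>S\<^esub>}"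
  by (rule finite_subset[OF _ assms]) (auto simp: map_zero)

text \<open>
  The sums on the two sides range over different supports, because \<open>f\<close> may kill coefficients of \<open>P\<close>.
\<close>

lemma map_subst_neg_der_lambda:
  assumes "finite {n. P n \<noteq> \<zero>\<^bsub>R\<^esub>}" "\<And>n. P n \<in> carrier R"
  shows "f (subst_neg_der_lambda R P k) = subst_neg_der_lambda S (\<lambda>n. f (P n)) k"
proof -
  let ?A = "{n. P n \<noteq> \<zero>\<^bsub>R\<^esub>}"
  let ?g = "\<lambda>n. (neg_der_lambda R ^^ n) (const_poly R (P n)) k"
  let ?h = "\<lambda>n. (neg_der_lambda S ^^ n) (const_poly S (f (P n))) k"
  have g: "?g n \<in> carrier R" for n
    by (intro R.neg_der_lambda_in R.const_poly_in R.carrier_is_submodule) (auto simp: R.der_closed assms)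
  have "const_poly R (P n) m \<in> carrier R" for n m
    by (simp add: const_poly_def assms)
  then have "f (?g n) = (neg_der_lambda S ^^ n) (\<lambda>m. f (const_poly R (P n) m)) k" for n
    by (rule map_neg_der_lambda)
  moreover have "(\<lambda>m. f (const_poly R (P n) m)) = const_poly S (f (P n))" for n
    by (simp add: const_poly_def fun_eq_iff map_zero)
  ultimately have f_g: "f (?g n) = ?h n" for n
    by simp
  have const_zero: "const_poly R \<zero>\<^bsub>R\<^esub> = (\<lambda>n. \<zero>\<^bsub>R\<^esub>)"
    by (simp add: const_poly_def fun_eq_iff)
  have "submodule {\<zero>\<^bsub>R\<^esub>} complex_ring R"
    by (rule R.submoduleI) auto
  then have "(neg_der_lambda R ^^ n) (const_poly R \<zero>\<^bsub>R\<^esub>) k \<in> {\<zero>\<^bsub>R\<^esub>}" for n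
    by (intro R.neg_der_lambda_in R.const_poly_in) auto
  moreover have "f ((neg_der_lambda R ^^ n) (const_poly R \<zero>\<^bsub>R\<^esub>) k)
      = (neg_der_lambda S ^^ n) (const_poly S \<zero>\<^bsub>S\<^esub>) k" for n
    unfolding const_zero by (subst map_neg_der_lambda) (simp_all add: const_poly_def map_zero cong: if_cong)
  ultimately have zero: "(neg_der_lambda S ^^ n) (const_poly S \<zero>\<^bsub>S\<^esub>) k = \<zero>\<^bsub>S\<^esub>" for n
    by (simp add: map_zero)
  have "subst_neg_der_lambda S (\<lambda>n. f (P n)) k = (\<Oplus>\<^bsub>S\<^esub>n\<in>?A. ?h n)"
    unfolding subst_neg_der_lambda_def
  proof (rule S.M.add.finprod_mono_neutral_cong_left)
    show "?h i = \<zero>\<^bsub>S\<^esub>" if "i \<in> ?A - {n. f (P n) \<noteq> \<zero>\<^bsub>S\<^esub>}" for i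
      using that zero by auto
    show "?h \<in> ?A \<rightarrow> carrier S"
      using g by (auto simp flip: f_g intro: map_closed)
  qed (use assms in \<open>auto simp: map_zero\<close>)
  then show ?thesis
    unfolding subst_neg_der_lambda_def using map_finsum[of ?g ?A] g by (simp add: f_g)
qed

lemma image_submodule:
  assumes "submodule U complex_ring R"
  shows "submodule (f ` U) complex_ring S"
proof -
  have U: "x \<in> carrier R" if "x \<in> U" for x
    using R.submoduleE(1)[OF assms] that by blast
  show ?thesis
  proof (rule S.submoduleI)
    show "f ` U \<subseteq> carrier S"
      using U map_closed by blast
    show "\<zero>\<^bsub>S\<^esub> \<in> f ` U"
      using submodule_zero_closed[OF assms] map_zero by (metis imageI)
    show "\<ominus>\<^bsub>S\<^esub> a \<in> f ` U" if "a \<in> f ` U" for a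
      using that R.submoduleE(3)[OF assms] U by (auto simp flip: map_minus)
    show "a \<oplus>\<^bsub>S\<^esub> b \<in> f ` U" if "a \<in> f ` U" "b \<in> f ` U" for a b
      using that R.submoduleE(5)[OF assms] U by (auto simp flip: map_add)
    show "a \<odot>\<^bsub>S\<^esub> x \<in> f ` U" if "x \<in> f ` U" for a x
      using that R.submoduleE(4)[OF assms] U by (auto simp flip: map_smult)
  qed
qed

theorem codomain_lie_conformal: "lie_conformal_superalgebra S"
proof (intro lie_conformal_superalgebra.intro lie_conformal_superalgebra_axioms.intro)
  note [simp] = R.part_closed R.bracket_closed R.der_closed
  note map = map_add map_smult map_der map_bracket map_minus map_diff
  show "module complex_ring S"
    by (rule codomain_module)
  show part: "submodule (part S p) complex_ring S" for p
    unfolding part_image by (intro image_submodule R.part_submodule)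
  show "part S 0 \<inter> part S 1 = {\<zero>\<^bsub>S\<^esub>}"
    using part_disjoint_image submodule_zero_closed[OF part] by blast
  show "carrier S = set_add S (part S 0) (part S 1)"
  proof (intro equalityI subsetI)
    fix y assume "y \<in> carrier S"
    then obtain x where "x \<in> carrier R" "y = f x"
      by (auto simp: carrier_image)
    moreover from this(1) obtain x\<^sub>0 x\<^sub>1 where "x\<^sub>0 \<in> part R 0" "x\<^sub>1 \<in> part R 1" "x = x\<^sub>0 \<oplus>\<^bsub>R\<^esub> x\<^sub>1"
      by (rule R.part_decompose)
    ultimately show "y \<in> set_add S (part S 0) (part S 1)"
      unfolding set_add_def' part_image by (auto simp: map)
  next
    fix y assume "y \<in> set_add S (part S 0) (part S 1)"
    then show "y \<in> carrier S"
      unfolding set_add_def' part_image by (auto simp: map_closed)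
  qed
  show "der S a \<in> part S p" if a: "a \<in> part S p" for a p
  proof -
    obtain x where x: "x \<in> part R p" "a = f x"
      using a by (auto simp: part_image)
    then have "der S a = f (der R x)"
      by (simp add: map_der)
    with x show ?thesis
      by (simp add: part_image R.der_even)
  qed
  show "lbracket S a b n \<in> part S (p + q)" if ab: "a \<in> part S p" "b \<in> part S q" for a b p q n
  proof -
    obtain x y where xy: "x \<in> part R p" "y \<in> part R q" "a = f x" "b = f y"
      using ab by (auto simp: part_image)
    then have "lbracket S a b n = f (lbracket R x y n)"
      by (simp add: map_bracket)
    with xy show ?thesis
      unfolding part_image by (blast intro: R.bracket_parity)
  qed
  show "lbracket S (der S a) b n = \<ominus>\<^bsub>S\<^esub> times_lambda S (lbracket S a b) n"
    if ab: "a \<in> part S p" "b \<in> part S q" for a b p q n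
  proof -
    obtain x y where xy: "x \<in> part R p" "y \<in> part R q" "a = f x" "b = f y"
      using ab by (auto simp: part_image)
    have "times_lambda R (lbracket R x y) n \<in> carrier R"
      using xy by (cases n) (simp_all add: times_lambda_def)
    then show ?thesis
      using arg_cong[OF R.sesquilinear_left[OF xy(1,2), of n], of f] xy
      by (simp add: map map_times_lambda)
  qed
  show "lbracket S a (der S b) n = der S (lbracket S a b n) \<oplus>\<^bsub>S\<^esub> times_lambda S (lbracket S a b) n"
    if ab: "a \<in> part S p" "b \<in> part S q" for a b p q n
  proof -
    obtain x y where xy: "x \<in> part R p" "y \<in> part R q" "a = f x" "b = f y"
      using ab by (auto simp: part_image)
    have "times_lambda R (lbracket R x y) n \<in> carrier R"
      using xy by (cases n) (simp_all add: times_lambda_def)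
    then show ?thesis
      using arg_cong[OF R.sesquilinear_right[OF xy(1,2), of n], of f] xy
      by (simp add: map map_times_lambda)
  qed
  show "lbracket S a b n = \<ominus>\<^bsub>S\<^esub> (koszul_sign p q \<odot>\<^bsub>S\<^esub> subst_neg_der_lambda S (lbracket S b a) n)"
    if ab: "a \<in> part S p" "b \<in> part S q" for a b p q n
  proof -
    obtain x y where xy: "x \<in> part R p" "y \<in> part R q" "a = f x" "b = f y"
      using ab by (auto simp: part_image)
    have closed: "subst_neg_der_lambda R (lbracket R y x) n \<in> carrier R"
      using xy by (intro R.subst_neg_der_lambda_in R.carrier_is_submodule) auto
    have "f (subst_neg_der_lambda R (lbracket R y x) n) = subst_neg_der_lambda S (lbracket S b a) n"
      using xy by (subst map_subst_neg_der_lambda) (simp_all add: R.bracket_finite map)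
    then show ?thesis
      using arg_cong[OF R.skew_symmetry[OF xy(1,2), of n], of f] xy closed
      by (simp add: map)
  qed
  show "lbracket S a (lbracket S b c n) m \<ominus>\<^bsub>S\<^esub> koszul_sign p q \<odot>\<^bsub>S\<^esub> lbracket S b (lbracket S a c m) n
      = (\<Oplus>\<^bsub>S\<^esub>k\<in>{..m}. of_nat ((m + n - k) choose n) \<odot>\<^bsub>S\<^esub> lbracket S (lbracket S a b k) c (m + n - k))"
    if abc: "a \<in> part S p" "b \<in> part S q" "c \<in> part S r" for a b c p q r m n
  proof -
    obtain x y z where xyz: "x \<in> part R p" "y \<in> part R q" "z \<in> part R r" "a = f x" "b = f y" "c = f z"
      using abc by (auto simp: part_image)
    then show ?thesis
      using arg_cong[OF R.jacobi[OF xyz(1,2,3), of n m], of f] xyz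
      by (simp add: map map_finsum)
  qed
qed (use R.der_closed R.bracket_closed in \<open>auto simp: carrier_image part_image R.der_even R.bracket_parity
      R.bracket_finite finite_support_image R.der_add R.der_smult
      R.bracket_add_left R.bracket_smult_left R.bracket_add_right R.bracket_smult_right
      simp flip: map_add map_smult map_der map_bracket\<close>)

lemma ideal_preimage:
  assumes J: "lie_conformal_ideal S J"
  shows "lie_conformal_ideal R {x \<in> carrier R. f x \<in> J}"
proof -
  interpret S': lie_conformal_superalgebra S
    by (rule codomain_lie_conformal)
  note sub = S'.ideal_submodule[OF J]
  have submodule: "submodule {x \<in> carrier R. f x \<in> J} complex_ring R"
    by (rule R.submoduleI)
      (auto simp: map_zero map_minus map_add map_smult submodule_zero_closed[OF sub] S.submoduleE(3-5)[OF sub])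
  show ?thesis
    unfolding R.lie_conformal_ideal_iff
  proof (intro conjI R.graded_submoduleI ballI allI submodule)
    fix x\<^sub>0 x\<^sub>1 assume x: "x\<^sub>0 \<in> part R 0" "x\<^sub>1 \<in> part R 1" "x\<^sub>0 \<oplus>\<^bsub>R\<^esub> x\<^sub>1 \<in> {x \<in> carrier R. f x \<in> J}"
    then have "f x\<^sub>0 \<oplus>\<^bsub>S\<^esub> f x\<^sub>1 \<in> J"
      by (simp add: map_add R.part_closed)
    with x J S'.graded_submodule_components[of J "f x\<^sub>0" "f x\<^sub>1"]
    show "x\<^sub>0 \<in> {x \<in> carrier R. f x \<in> J}" "x\<^sub>1 \<in> {x \<in> carrier R. f x \<in> J}"
      by (auto simp: part_image S'.lie_conformal_ideal_iff R.part_closed)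
  qed (use J in \<open>auto simp: S'.lie_conformal_ideal_iff map_der map_bracket R.der_closed
        R.bracket_closed map_closed\<close>)
qed

end

text \<open>
  Every operation of the quotient is a union of cosets over all representatives; the union is a single
  coset because \<open>I\<close> is an ideal.  The components of the quotient are independent because \<open>I\<close> is graded.
\<close>

lemma (in lie_conformal_superalgebra) quotient_epimorphism:
  assumes I: "lie_conformal_ideal R I"
  shows "lie_conformal_epimorphism R (quotient_lie_conformal R I) (\<lambda>x. I +> x)"
proof -
  let ?Q = "quotient_lie_conformal R I"
  note sub = ideal_submodule[OF I]
  have I_carrier: "x \<in> carrier R" if "x \<in> I" for x
    using submoduleE(1)[OF sub] that by blast
  interpret I: abelian_subgroup I R
    by (rule abelian_subgroupI3)
      (use submodule.axioms(1)[OF sub] M.abelian_group_axioms in \<open>auto intro: additive_subgroup.intro\<close>)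
  have coset: "\<exists>i\<in>I. y = i \<oplus> x" if "y \<in> I +> x" for x y
    using that by (auto simp: a_r_coset_def')
  have coset_eq: "I +> (i \<oplus> x) = I +> x" if "i \<in> I" "x \<in> carrier R" for i x
    using I.a_rcos_sum[of i x] I.a_rcos_sum[of \<zero> x] I.a_rcos_const that I_carrier
      submodule_zero_closed[OF sub] by simp
  have Union_coset: "(\<Union>y\<in>I +> x. I +> g y) = I +> g x"
    if x: "x \<in> carrier R" and "g x \<in> carrier R" and g: "\<And>i. i \<in> I \<Longrightarrow> \<exists>j\<in>I. g (i \<oplus> x) = j \<oplus> g x" for g x
  proof -
    have "\<forall>y\<in>I +> x. I +> g y = I +> g x"
      using coset[of _ x] g coset_eq \<open>g x \<in> carrier R\<close> by metis
    with I.a_rcos_self[OF x] show ?thesis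
      by (rule UN_constant_eq)
  qed
  show ?thesis
  proof (intro lie_conformal_epimorphism.intro lie_conformal_epimorphism_axioms.intro)
    show "lie_conformal_superalgebra R"
      by (rule lie_conformal_superalgebra_axioms)
    show "part ?Q 0 \<inter> part ?Q 1
        \<subseteq> {\<zero>\<^bsub>?Q\<^esub>}"
    proof
      fix A assume "A \<in> part ?Q 0 \<inter> part ?Q 1"
      then obtain x\<^sub>0 x\<^sub>1 where x: "x\<^sub>0 \<in> part R 0" "x\<^sub>1 \<in> part R 1" "A = I +> x\<^sub>0" "A = I +> x\<^sub>1"
        by (auto simp: quotient_lie_conformal_def)
      then have "x\<^sub>0 \<oplus> \<ominus> x\<^sub>1 \<in> I"
        using I.a_rcos_self[of x\<^sub>0] I.a_rcos_module_imp[of x\<^sub>1 x\<^sub>0] by (simp add: part_closed)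
      then have "x\<^sub>0 \<in> I"
        using graded_submodule_components[of I x\<^sub>0 "\<ominus> x\<^sub>1"] x I submoduleE(3)[OF part_submodule]
        by (auto simp: lie_conformal_ideal_iff)
      then show "A \<in> {\<zero>\<^bsub>?Q\<^esub>}"
        by (simp add: quotient_lie_conformal_def x(3) I.a_rcos_const)
    qed
    fix x y k n assume x: "x \<in> carrier R"
    show "I +> (k \<odot> x) = k \<odot>\<^bsub>?Q\<^esub> (I +> x)"
      using x by (simp add: quotient_lie_conformal_def)
        (subst Union_coset; use sub in \<open>auto simp: smult_r_distr I_carrier submoduleE(4)\<close>)
    show "I +> der R x = der ?Q (I +> x)"
      using x by (simp add: quotient_lie_conformal_def)
        (subst Union_coset; use I in \<open>auto simp: der_closed der_add I_carrier lie_conformal_ideal_iff\<close>)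
    assume y: "y \<in> carrier R"
    show "I +> (x \<oplus> y) = (I +> x) \<oplus>\<^bsub>?Q\<^esub> (I +> y)"
      using x y by (simp add: quotient_lie_conformal_def I.a_rcos_sum)
    have "(\<Union>y'\<in>I +> y. I +> lbracket R x' y' n) = I +> lbracket R x' y n" if "x' \<in> carrier R" for x'
      using that y I by (subst Union_coset)
        (auto simp: bracket_closed bracket_add_right I_carrier lie_conformal_ideal_iff)
    then have "(\<Union>x'\<in>I +> x. \<Union>y'\<in>I +> y. I +> lbracket R x' y' n) = (\<Union>x'\<in>I +> x. I +> lbracket R x' y n)"
      using I.a_elemrcos_carrier[OF x] by simp
    also have "\<dots> = I +> lbracket R x y n"
      using x y ideal_bracket_left[OF I]
      by (subst Union_coset) (auto simp: bracket_closed bracket_add_left I_carrier)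
    finally show "I +> lbracket R x y n = lbracket ?Q (I +> x) (I +> y) n"
      by (simp add: quotient_lie_conformal_def)
  qed (use submodule_zero_closed[OF sub] in \<open>auto simp: quotient_lie_conformal_def A_RCOSETS_def' I.a_rcos_const\<close>)
qed

theorem (in lie_conformal_superalgebra) simple_quotient:
  assumes I: "lie_conformal_ideal R I"
    and maximal: "\<And>J. lie_conformal_ideal R J \<Longrightarrow> I \<subseteq> J \<Longrightarrow> J = I \<or> J = carrier R"
    and nonabelian: "a \<in> carrier R" "b \<in> carrier R" "lbracket R a b n \<notin> I"
  shows "simple_lie_conformal (quotient_lie_conformal R I)"
proof -
  let ?Q = "quotient_lie_conformal R I"
  interpret lie_conformal_epimorphism R ?Q "\<lambda>x. I +> x"
    by (rule quotient_epimorphism[OF I])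
  interpret Q: lie_conformal_superalgebra ?Q
    by (rule codomain_lie_conformal)
  note sub = ideal_submodule[OF I]
  have zero: "\<zero>\<^bsub>?Q\<^esub> = I"
    by (simp add: quotient_lie_conformal_def)
  interpret I: abelian_subgroup I R
    by (rule abelian_subgroupI3)
      (use submodule.axioms(1)[OF sub] M.abelian_group_axioms in \<open>auto intro: additive_subgroup.intro\<close>)
  have coset_zero: "I +> x = I \<longleftrightarrow> x \<in> I" if "x \<in> carrier R" for x
    using I.a_rcos_self[OF that] I.a_rcos_const by auto
  have "J = {\<zero>\<^bsub>?Q\<^esub>} \<or> J = carrier ?Q" if J: "lie_conformal_ideal ?Q J" for J
  proof -
    let ?J = "{x \<in> carrier R. I +> x \<in> J}"
    have J_image: "J = (\<lambda>x. I +> x) ` ?J"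
      using S.submoduleE(1)[OF Q.ideal_submodule[OF J]] by (auto simp: carrier_image)
    have "I \<in> J"
      using submodule_zero_closed[OF Q.ideal_submodule[OF J]] by (simp add: zero)
    then have "I \<subseteq> ?J"
      using submoduleE(1)[OF sub] I.a_rcos_const by auto
    then consider "?J = I" | "?J = carrier R"
      using maximal[OF ideal_preimage[OF J]] by blast
    then show ?thesis
    proof cases
      case 1
      have "J = (\<lambda>x. I) ` I"
        using J_image[unfolded 1] I.a_rcos_const by (simp cong: image_cong)
      also have "\<dots> = {I}"
        using submodule_zero_closed[OF sub] by (rule image_constant)
      finally show ?thesis
        by (simp add: zero)
    next
      case 2
      show ?thesis
        using J_image[unfolded 2] by (simp add: carrier_image)
    qed
  qed
  moreover have "\<not> abelian_lie_conformal ?Q"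
  proof -
    have "lbracket ?Q (I +> a) (I +> b) n \<noteq> \<zero>\<^bsub>?Q\<^esub>"
      using nonabelian by (simp add: zero coset_zero bracket_closed flip: map_bracket)
    then show ?thesis
      unfolding abelian_lie_conformal_def Q.bracket_span_eq_zero_iff
      using nonabelian map_closed by blast
  qed
  ultimately show ?thesis
    using Q.lie_conformal_superalgebra_axioms by (simp add: simple_lie_conformal_def)
qed

section \<open>The Lie conformal superalgebra of a vertex superalgebra\<close>

lemma underlying_lie_simps [simp]:
  "carrier (underlying_lie V) = UNIV" "\<zero>\<^bsub>underlying_lie V\<^esub> = 0" "x \<oplus>\<^bsub>underlying_lie V\<^esub> y = x + y"
  "k \<odot>\<^bsub>underlying_lie V\<^esub> x = vscale V k x" "part (underlying_lie V) = vpart V"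
  "der (underlying_lie V) = transl V"
  "lbracket (underlying_lie V) a b n = vscale V (1 / fact n) (mode V a (int n) b)"
  by (simp_all add: underlying_lie_def)

context vertex_superalgebra
begin

lemma underlying_module: "module complex_ring (underlying_lie V)"
proof (rule moduleI)
  show "cring complex_ring"
    by (rule cring_from_type_algebra)
  show "abelian_group (underlying_lie V)"
    by (rule abelian_groupI) (auto simp: add.assoc add.commute intro: exI[of _ "- x" for x])
qed (simp_all add: scale_left_distrib scale_right_distrib)

sublocale L: module complex_ring "underlying_lie V"
  by (rule underlying_module)

lemma underlying_minus [simp]: "\<ominus>\<^bsub>underlying_lie V\<^esub> x = - x"
  by (rule L.M.minus_equality) simp_all

lemma underlying_diff [simp]: "x \<ominus>\<^bsub>underlying_lie V\<^esub> y = x - y"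
  by (simp add: a_minus_def)

lemma underlying_finsum [simp]: "finite A \<Longrightarrow> (\<Oplus>\<^bsub>underlying_lie V\<^esub>i\<in>A. g i) = (\<Sum>i\<in>A. g i)"
  by (induction A rule: finite_induct) (simp_all add: L.M.finsum_insert)

lemma underlying_submodule_iff: "submodule U complex_ring (underlying_lie V) \<longleftrightarrow> subspace U"
proof
  assume U: "submodule U complex_ring (underlying_lie V)"
  show "subspace U"
    using L.submoduleE(4,5)[OF U] submodule_zero_closed[OF U] by (auto intro: subspaceI)
next
  assume "subspace U"
  then show "submodule U complex_ring (underlying_lie V)"
    by (intro L.submoduleI) (auto intro: subspace_0 subspace_neg subspace_add subspace_scale)
qed

lemma underlying_subst_neg_der_lambda:
  assumes "\<And>j. j \<ge> J \<Longrightarrow> P j = 0"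
  shows "subst_neg_der_lambda (underlying_lie V) P n
    = (\<Sum>j\<in>{n..<J}. vscale V ((-1) ^ j * of_nat (j choose n)) ((transl V ^^ (j - n)) (P j)))"
proof -
  let ?L = "underlying_lie V"
  have step: "neg_der_lambda ?L Q m
      = - (transl V (Q m) + times_lambda ?L Q m)" for Q m
    by (simp add: neg_der_lambda_def)
  have power: "(neg_der_lambda ?L ^^ j) (const_poly ?L x) n
      = vscale V ((-1) ^ j * of_nat (j choose n)) ((transl V ^^ (j - n)) x)" for j n x
  proof (induction j arbitrary: n)
    case 0
    then show ?case
      by (cases n) (simp_all add: const_poly_def)
  next
    case (Suc j)
    note IH = Suc
    let ?Q = "(neg_der_lambda ?L ^^ j) (const_poly ?L x)"
    show ?case
    proof (cases n)
      case 0
      then show ?thesis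
        by (simp add: IH step[of ?Q] times_lambda_def transl_scale)
    next
      case (Suc i)
      have shift: "vscale V (of_nat (j choose Suc i)) (transl V ((transl V ^^ (j - Suc i)) x))
          = vscale V (of_nat (j choose Suc i)) ((transl V ^^ (j - i)) x)"
      proof (cases "Suc i \<le> j")
        case True
        then have "j - i = Suc (j - Suc i)"
          by simp
        then show ?thesis
          by simp
      qed simp
      have "(neg_der_lambda ?L ^^ Suc j) (const_poly ?L x) n
          = - (vscale V ((-1) ^ j) (vscale V (of_nat (j choose Suc i)) (transl V ((transl V ^^ (j - Suc i)) x)))
              + vscale V ((-1) ^ j * of_nat (j choose i)) ((transl V ^^ (j - i)) x))"
        by (simp add: Suc IH step[of ?Q] times_lambda_def transl_scale)
      also have "\<dots> = vscale V ((-1) ^ Suc j * of_nat (Suc j choose n)) ((transl V ^^ (Suc j - n)) x)"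
        unfolding shift by (simp add: Suc scale_left_distrib algebra_simps)
      finally show ?thesis .
    qed
  qed
  have sub: "{j. P j \<noteq> 0} \<subseteq> {..<J}"
    using assms by (auto simp: not_le[symmetric])
  have "(transl V ^^ k) 0 = 0" for k
    by (induction k) simp_all
  then have "(\<Sum>j\<in>{j. P j \<noteq> 0}. vscale V ((-1) ^ j * of_nat (j choose n)) ((transl V ^^ (j - n)) (P j)))
      = (\<Sum>j\<in>{..<J}. vscale V ((-1) ^ j * of_nat (j choose n)) ((transl V ^^ (j - n)) (P j)))"
    by (intro sum.mono_neutral_left sub) auto
  also have "\<dots> = (\<Sum>j\<in>{n..<J}. vscale V ((-1) ^ j * of_nat (j choose n)) ((transl V ^^ (j - n)) (P j)))"
    by (rule sum.mono_neutral_right) auto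
  finally show ?thesis
    using finite_subset[OF sub] by (simp add: subst_neg_der_lambda_def power)
qed

text \<open>
  Skew-symmetry and the commutator formula of the vertex superalgebra become skew-symmetry and the
  Jacobi identity once the factorials are distributed over the binomial coefficients.
\<close>

theorem underlying_lie_conformal: "lie_conformal_superalgebra (underlying_lie V)"
proof (intro lie_conformal_superalgebra.intro lie_conformal_superalgebra_axioms.intro)
  let ?L = "underlying_lie V"
  show "module complex_ring ?L"
    by (rule underlying_module)
  show "submodule (part ?L p) complex_ring ?L" for p
    by (simp add: underlying_submodule_iff part_subspace)
  show "part ?L 0 \<inter> part ?L 1 = {\<zero>\<^bsub>?L\<^esub>}"
    by (simp add: part_disjoint)
  show "carrier ?L = set_add ?L (part ?L 0) (part ?L 1)"
    using part_sum by (fastforce simp: set_add_def')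
  fix a b p q and n :: nat
  have "\<exists>N. \<forall>n\<ge>N. mode V a (int n) b = 0"
    by (rule mode_bound)
  then obtain N where N: "\<forall>n\<ge>N. mode V a (int n) b = 0" ..
  then have "{n. lbracket ?L a b n \<noteq> \<zero>\<^bsub>?L\<^esub>} \<subseteq> {..<N}"
    by (auto simp: not_le[symmetric])
  then show "finite {n. lbracket ?L a b n \<noteq> \<zero>\<^bsub>?L\<^esub>}"
    by (rule finite_subset) simp
  show "lbracket ?L (der ?L a) b n
      = \<ominus>\<^bsub>?L\<^esub> times_lambda ?L (lbracket ?L a b) n"
  proof (cases n)
    case (Suc k)
    have "int (Suc k) - 1 = int k" "1 / fact (Suc k) * of_nat (Suc k) = (1 / fact k :: complex)"
      unfolding fact_Suc by (simp_all del: of_nat_Suc)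
    then show ?thesis
      by (simp only: Suc underlying_lie_simps underlying_minus times_lambda_def nat.case
          transl_derivative scale_scale of_int_minus of_int_of_nat_eq mult_minus_right scale_minus_left scale_minus_right)
  qed (simp add: times_lambda_def transl_derivative)
  show "lbracket ?L a (der ?L b) n
      = der ?L (lbracket ?L a b n)
        \<oplus>\<^bsub>?L\<^esub> times_lambda ?L (lbracket ?L a b) n"
  proof (cases n)
    case (Suc k)
    have "int (Suc k) - 1 = int k" "1 / fact (Suc k) * of_nat (Suc k) = (1 / fact k :: complex)"
      unfolding fact_Suc by (simp_all del: of_nat_Suc)
    then show ?thesis
      by (simp only: Suc underlying_lie_simps times_lambda_def nat.case mode_transl transl_scale
          scale_right_distrib scale_scale of_int_of_nat_eq)
  qed (simp add: times_lambda_def mode_transl)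
  assume ab: "a \<in> part ?L p" "b \<in> part ?L q"
  show "lbracket ?L a b n = \<ominus>\<^bsub>?L\<^esub> (koszul_sign p q \<odot>\<^bsub>?L\<^esub>
      subst_neg_der_lambda ?L (lbracket ?L b a) n)"
  proof -
    obtain J where J: "\<forall>j\<ge>J. mode V b (int j) a = 0"
      using mode_bound by blast
    have scaled: "vscale V (1 / fact n) (\<Sum>j\<in>{n..<J}. vscale V ((-1) ^ j / fact (j - n))
              ((transl V ^^ (j - n)) (mode V b (int j) a)))
        = (\<Sum>j\<in>{n..<J}. vscale V ((-1) ^ j * of_nat (j choose n))
              ((transl V ^^ (j - n)) (vscale V (1 / fact j) (mode V b (int j) a))))"
      unfolding scale_sum_right
    proof (rule sum.cong)
      fix j assume "j \<in> {n..<J}"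
      then have "of_nat (j choose n) = (fact j / (fact n * fact (j - n)) :: complex)"
        by (simp add: binomial_fact)
      moreover have "(transl V ^^ k) (vscale V c x) = vscale V c ((transl V ^^ k) x)" for k c x
        by (induction k) (simp_all add: transl_scale)
      ultimately show "vscale V (1 / fact n) (vscale V ((-1) ^ j / fact (j - n)) ((transl V ^^ (j - n)) (mode V b (int j) a)))
          = vscale V ((-1) ^ j * of_nat (j choose n))
              ((transl V ^^ (j - n)) (vscale V (1 / fact j) (mode V b (int j) a)))"
        by simp
    qed simp
    have subst: "subst_neg_der_lambda ?L (lbracket ?L b a) n
        = (\<Sum>j\<in>{n..<J}. vscale V ((-1) ^ j * of_nat (j choose n))
              ((transl V ^^ (j - n)) (vscale V (1 / fact j) (mode V b (int j) a))))"
      by (subst underlying_subst_neg_der_lambda[where J = J]) (simp_all add: J)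
    have "a \<in> vpart V p" "b \<in> vpart V q"
      using ab by simp_all
    from skew_symmetry[OF this J, of n] show ?thesis
      unfolding subst scaled[symmetric] by simp
  qed
  fix c r and m :: nat assume c: "c \<in> part ?L r"
  show "lbracket ?L a (lbracket ?L b c n) m
      \<ominus>\<^bsub>?L\<^esub> koszul_sign p q \<odot>\<^bsub>?L\<^esub>
        lbracket ?L b (lbracket ?L a c m) n
      = (\<Oplus>\<^bsub>?L\<^esub>k\<in>{..m}. of_nat ((m + n - k) choose n) \<odot>\<^bsub>?L\<^esub>
          lbracket ?L (lbracket ?L a b k) c (m + n - k))"
  proof -
    let ?x = "\<lambda>k. mode V (mode V a (int k) b) (int (m + n - k)) c"
    have "supercommutator p a q b (int m) (int n) c
        = (\<Sum>k<N. vscale V (of_nat (m choose k)) (mode V (mode V a (int k) b) (int m + int n - int k) c))"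
      using ab N by (simp add: commutator_formula_nonneg)
    also have "\<dots> = (\<Sum>k\<in>{..<N} \<union> {..m}. vscale V (of_nat (m choose k)) (mode V (mode V a (int k) b) (int m + int n - int k) c))"
      by (rule sum.mono_neutral_left) (auto simp: N)
    also have "\<dots> = (\<Sum>k\<le>m. vscale V (of_nat (m choose k)) (mode V (mode V a (int k) b) (int m + int n - int k) c))"
      by (rule sum.mono_neutral_right) auto
    also have "\<dots> = (\<Sum>k\<le>m. vscale V (of_nat (m choose k)) (?x k))"
      by (rule sum.cong) (auto simp: of_nat_diff)
    finally have "vscale V (1 / (fact m * fact n)) (supercommutator p a q b (int m) (int n) c)
        = (\<Sum>k\<le>m. vscale V (1 / (fact m * fact n) * of_nat (m choose k)) (?x k))"
      by (simp add: scale_sum_right)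
    also have "\<dots> = (\<Sum>k\<le>m. vscale V (of_nat ((m + n - k) choose n) * (1 / fact (m + n - k)) * (1 / fact k)) (?x k))"
    proof (rule sum.cong)
      fix k assume "k \<in> {..m}"
      then have "of_nat (m choose k) = (fact m / (fact k * fact (m - k)) :: complex)"
        and "of_nat ((m + n - k) choose n) = (fact (m + n - k) / (fact n * fact (m - k)) :: complex)"
        by (simp_all add: binomial_fact)
      then show "vscale V (1 / (fact m * fact n) * of_nat (m choose k)) (?x k)
          = vscale V (of_nat ((m + n - k) choose n) * (1 / fact (m + n - k)) * (1 / fact k)) (?x k)"
        by simp
    qed simp
    finally show ?thesis
      by (simp add: supercommutator_def mode_scale_left mode_scale_right scale_right_diff_distrib mult_ac)
  qed
qed (simp_all add: transl_add transl_scale transl_even mode_add_left mode_add_right mode_scale_left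
    mode_scale_right scale_right_distrib mult.commute mode_parity subspace_scale[OF part_subspace]
    del: add_bit_eq_xor)

sublocale L: lie_conformal_superalgebra "underlying_lie V"
  by (rule underlying_lie_conformal)

lemma graded_submodule_underlying_iff:
  "graded_submodule (underlying_lie V) U \<longleftrightarrow> graded_subspace V U"
proof -
  have "U = set_add (underlying_lie V) (U \<inter> vpart V 0) (U \<inter> vpart V 1) \<longleftrightarrow>
      (\<forall>x\<in>U. \<exists>x\<^sub>0\<in>U \<inter> vpart V 0. \<exists>x\<^sub>1\<in>U \<inter> vpart V 1. x = x\<^sub>0 + x\<^sub>1)" if "subspace U"
    using subspace_add[OF that] unfolding set_add_def' by fastforce
  then show ?thesis
    unfolding graded_submodule_def graded_subspace_def underlying_submodule_iff by auto
qed

lemma scale_fact_in_iff: "subspace U \<Longrightarrow> vscale V (1 / fact n) x \<in> U \<longleftrightarrow> x \<in> U"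
  using subspace_scale[of U x "1 / fact n"] subspace_scale[of U "vscale V (1 / fact n) x" "fact n"]
  by auto

lemma lie_conformal_ideal_underlying_iff:
  "lie_conformal_ideal (underlying_lie V) I \<longleftrightarrow>
     graded_subspace V I \<and> transl V ` I \<subseteq> I \<and> (\<forall>x\<in>I. \<forall>c n. mode V c (int n) x \<in> I)"
  unfolding L.lie_conformal_ideal_iff graded_submodule_underlying_iff
  using graded_subspace_imp_subspace[of I] by (auto simp: scale_fact_in_iff)

definition derived :: "'v set" where
  "derived = bracket_span (underlying_lie V) UNIV UNIV"

lemma derived_subset_iff: "subspace U \<Longrightarrow> derived \<subseteq> U \<longleftrightarrow> (\<forall>a b n. mode V a (int n) b \<in> U)"
  unfolding derived_def by (simp add: bracket_span_subset_iff underlying_submodule_iff scale_fact_in_iff)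

lemma subspace_derived: "subspace derived"
  unfolding derived_def underlying_submodule_iff[symmetric] by (rule L.submodule_bracket_span) simp_all

lemma mode_in_derived: "mode V a (int n) b \<in> derived"
  using derived_subset_iff[OF subspace_derived] by blast

text \<open>
  The brackets of homogeneous vectors are homogeneous, and they span.
\<close>

lemma graded_derived: "graded_subspace V derived"
proof -
  let ?K = "{x\<^sub>0 + x\<^sub>1 | x\<^sub>0 x\<^sub>1. x\<^sub>0 \<in> derived \<inter> vpart V 0 \<and> x\<^sub>1 \<in> derived \<inter> vpart V 1}"
  have "subspace ?K"
    by (intro subspace_sums subspace_inter subspace_derived part_subspace)
  moreover have "mode V a (int n) b \<in> ?K" for a n b
  proof -
    obtain a\<^sub>0 a\<^sub>1 where a: "a\<^sub>0 \<in> vpart V 0" "a\<^sub>1 \<in> vpart V 1" "a = a\<^sub>0 + a\<^sub>1"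
      using part_sum by blast
    obtain b\<^sub>0 b\<^sub>1 where b: "b\<^sub>0 \<in> vpart V 0" "b\<^sub>1 \<in> vpart V 1" "b = b\<^sub>0 + b\<^sub>1"
      using part_sum by blast
    \<comment> \<open>parities add up modulo two, so the bracket of two odd vectors is even\<close>
    let ?even = "mode V a\<^sub>0 (int n) b\<^sub>0 + mode V a\<^sub>1 (int n) b\<^sub>1"
    let ?odd = "mode V a\<^sub>0 (int n) b\<^sub>1 + mode V a\<^sub>1 (int n) b\<^sub>0"
    have "?even \<in> derived \<inter> vpart V 0" "?odd \<in> derived \<inter> vpart V 1"
      using mode_parity[OF a(1) b(1)] mode_parity[OF a(1) b(2)] mode_parity[OF a(2) b(1)]
        mode_parity[OF a(2) b(2)]
      by (auto intro!: subspace_add subspace_derived part_subspace mode_in_derived)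
    moreover have "mode V a (int n) b = ?even + ?odd"
      by (simp add: a b mode_add_left mode_add_right algebra_simps)
    ultimately show ?thesis by blast
  qed
  ultimately have "derived \<subseteq> ?K"
    by (simp add: derived_subset_iff)
  then show ?thesis
    unfolding graded_subspace_def using subspace_derived by blast
qed

lemma transl_derived: "transl V ` derived \<subseteq> derived"
proof -
  have "subspace {x. transl V x \<in> derived}"
    using subspace_derived
    by (auto intro!: subspaceI simp: transl_add transl_scale subspace_0 subspace_add subspace_scale)
  moreover have "transl V (mode V a (int n) b) \<in> derived" for a n b
  proof -
    have "transl V (mode V a (int n) b) = mode V (transl V a) (int n) b + mode V a (int n) (transl V b)"
      using transl_commutator[of a "int n" b] by (simp add: algebra_simps)
    then show ?thesis
      by (simp add: subspace_add subspace_derived mode_in_derived)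
  qed
  ultimately have "derived \<subseteq> {x. transl V x \<in> derived}"
    by (simp add: derived_subset_iff)
  then show ?thesis by blast
qed

definition centre :: "'v set" where
  "centre = {x. \<forall>c n. mode V c (int n) x = 0}"

lemma subspace_centre: "subspace centre"
  unfolding centre_def by (auto intro!: subspaceI simp: mode_add_right mode_scale_right)

lemma ideal_centre: "lie_conformal_ideal (underlying_lie V) centre"
  unfolding lie_conformal_ideal_underlying_iff
proof (intro conjI)
  have "graded_subspace V {0}"
  proof (rule graded_subspaceI[OF subspace_single_0])
    fix x\<^sub>0 x\<^sub>1 assume x: "x\<^sub>0 \<in> vpart V 0" "x\<^sub>1 \<in> vpart V 1" "x\<^sub>0 + x\<^sub>1 \<in> {0}"
    then have "x\<^sub>0 = - x\<^sub>1"
      by (simp add: eq_neg_iff_add_eq_0)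
    then have "x\<^sub>0 \<in> vpart V 0 \<inter> vpart V 1"
      using x(1) subspace_neg[OF part_subspace x(2)] by simp
    then have "x\<^sub>0 = 0"
      unfolding part_disjoint by simp
    then show "x\<^sub>0 \<in> {0} \<and> x\<^sub>1 \<in> {0}"
      using x(3) by simp
  qed
  then show "graded_subspace V centre"
    using graded_transporter[of "{0}" "range int"] by (simp add: centre_def)
  show "transl V ` centre \<subseteq> centre"
  proof clarify
    fix x assume "x \<in> centre"
    then have "mode V c (int n) x = 0" "mode V (transl V c) (int n) x = 0" for c n
      by (simp_all add: centre_def)
    then show "transl V x \<in> centre"
      using transl_commutator[of _ "int _" x] by (simp add: centre_def)
  qed
  show "\<forall>x\<in>centre. \<forall>c n. mode V c (int n) x \<in> centre"
    by (simp add: centre_def)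
qed

end

theorem corollary5p1:
  fixes V :: "'v::ab_group_add vertex_data"
  assumes "vertex_superalgebra V"
    and "simple_vertex V"
  shows "abelian_lie_conformal (underlying_lie V) \<or>
    (\<exists>L :: 'v set lie_conformal. simple_lie_conformal L \<and>
       irreducible_central_extension (underlying_lie V) L)"
proof -
  interpret vertex_superalgebra V
    by (rule assms(1))
  let ?Q = "quotient_lie_conformal (underlying_lie V) centre"
  show ?thesis
  proof (cases "\<forall>a n b. mode V a (int n) b = 0")
    case True
    then have "abelian_lie_conformal (underlying_lie V)"
      unfolding abelian_lie_conformal_def L.bracket_span_eq_zero_iff by simp
    then show ?thesis ..
  next
    case False
    then have derived: "derived = UNIV"
      using simple_derived[OF assms(2) graded_derived transl_derived mode_in_derived] by blast
    have "\<not> derived \<subseteq> centre"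
      using False by (auto simp: derived centre_def)
    then obtain a n b where ab: "mode V a (int n) b \<notin> centre"
      using derived_subset_iff[OF subspace_centre] by blast
    have "simple_lie_conformal ?Q"
    proof (rule L.simple_quotient[OF ideal_centre])
      fix J assume "lie_conformal_ideal (underlying_lie V) J" "centre \<subseteq> J"
      then show "J = centre \<or> J = carrier (underlying_lie V)"
        using simple_Lie_ideal[OF assms(2), of J]
        by (auto simp: lie_conformal_ideal_underlying_iff centre_def)
    next
      show "lbracket (underlying_lie V) a b n \<notin> centre"
        using ab by (simp add: scale_fact_in_iff subspace_centre)
    qed simp_all
    moreover have "irreducible_central_extension (underlying_lie V) ?Q"
    proof -
      have "central_ideal (underlying_lie V) centre"
        unfolding central_ideal_def L.bracket_span_eq_zero_iff
        using ideal_centre by (simp add: centre_def)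
      moreover have "id \<in> lie_conformal_iso ?Q ?Q"
        by (simp add: lie_conformal_iso_def)
      ultimately have "central_extension (underlying_lie V) ?Q"
        unfolding central_extension_def
        using underlying_lie_conformal \<open>simple_lie_conformal ?Q\<close>
        by (auto simp: simple_lie_conformal_def)
      then show ?thesis
        using derived by (simp add: irreducible_central_extension_def derived_def)
    qed
    ultimately show ?thesis by blast
  qed
qed

end
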